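(* Let $R$ be a semiprime left Goldie ring, $\sigma$ an injective endomorphism of $R$, and $\delta$ a $\sigma$-derivation of $R$. Then $R[x;\sigma,\delta]$ is also a semiprime left Goldie ring.
   Context: All rings are associative with unity, and ring endomorphisms preserve the unity. A $\sigma$-derivation of $R$ is an additive map $\delta:R\to R$ with $\delta(ab)=\sigma(a)\delta(b)+\delta(a)b$. The Ore extension $R[x;\sigma,\delta]$ is the ring of polynomials $\sum a_ix^i$ with coefficients from $R$ written on the left and multiplication determined by $xr=\sigma(r)x+\delta(r)$ for $r\in R$. A ring is left Goldie if it has finite left uniform dimension and satisfies the ascending chain condition on left annihilators. *)

theory Defs
  imports "HOL-Algebra.UnivPoly" "HOL-Algebra.Ideal_Product"
begin

section \<open>Semiprime left Goldie rings\<close>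

text \<open>
  The locale \<^locale>\<open>ring\<close> is that of associative, not necessarily commutative rings with unity.
  It does not exclude the zero ring.
\<close>

locale left_ideal = additive_subgroup I R + ring R for I and R (structure) +
  assumes I_l_closed: "\<lbrakk>a \<in> I; x \<in> carrier R\<rbrakk> \<Longrightarrow> x \<otimes> a \<in> I"

text \<open>
  The power \<open>I\<^sup>n\<close> is the ideal generated by the products of \<open>n\<close> elements of \<open>I\<close>,
  with \<open>I\<^sup>0\<close> the whole ring.
\<close>

definition nilpotent_ideal :: "('a, 'm) ring_scheme \<Rightarrow> 'a set \<Rightarrow> bool" where
  "nilpotent_ideal R I \<longleftrightarrow>
     ideal I R \<and> (\<exists>n::nat. (ideal_prod R I ^^ n) (carrier R) = {\<zero>\<^bsub>R\<^esub>})"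

definition semiprime_ring :: "('a, 'm) ring_scheme \<Rightarrow> bool" where
  "semiprime_ring R \<longleftrightarrow> ring R \<and> (\<forall>I. nilpotent_ideal R I \<longrightarrow> I = {\<zero>\<^bsub>R\<^esub>})"

definition left_annihilator :: "('a, 'm) ring_scheme \<Rightarrow> 'a set \<Rightarrow> 'a set" where
  "left_annihilator R S = {r \<in> carrier R. \<forall>s\<in>S. r \<otimes>\<^bsub>R\<^esub> s = \<zero>\<^bsub>R\<^esub>}"

definition acc_left_annihilators :: "('a, 'm) ring_scheme \<Rightarrow> bool" where
  "acc_left_annihilators R \<longleftrightarrow>
     (\<forall>C :: nat \<Rightarrow> 'a set.
        (\<forall>n. \<exists>S \<subseteq> carrier R. C n = left_annihilator R S) \<longrightarrow> (\<forall>n. C n \<subseteq> C (Suc n)) \<longrightarrow>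
        (\<exists>N. \<forall>n\<ge>N. C n = C N))"

text \<open>The sum of the members of the family \<open>\<J>\<close> of left ideals is direct.\<close>

definition direct_left_ideals :: "('a, 'm) ring_scheme \<Rightarrow> 'a set set \<Rightarrow> bool" where
  "direct_left_ideals R \<J> \<longleftrightarrow>
     (\<forall>J\<in>\<J>. left_ideal J R) \<and>
     (\<forall>F y. finite F \<longrightarrow> F \<subseteq> \<J> \<longrightarrow> y \<in> (\<Pi> J\<in>F. J) \<longrightarrow> (\<Oplus>\<^bsub>R\<^esub>J\<in>F. y J) = \<zero>\<^bsub>R\<^esub> \<longrightarrow>
        (\<forall>J\<in>F. y J = \<zero>\<^bsub>R\<^esub>))"

text \<open>
  Finite left uniform dimension: the left module \<open>R\<close> contains no infinite direct sum of nonzero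
  submodules. Distinct indices of a direct sum of nonzero left ideals carry distinct left ideals,
  so it is enough to consider families given as sets.
\<close>

definition finite_left_uniform_dim :: "('a, 'm) ring_scheme \<Rightarrow> bool" where
  "finite_left_uniform_dim R \<longleftrightarrow>
     \<not> (\<exists>\<J>. infinite \<J> \<and> (\<forall>J\<in>\<J>. J \<noteq> {\<zero>\<^bsub>R\<^esub>}) \<and> direct_left_ideals R \<J>)"

definition left_goldie_ring :: "('a, 'm) ring_scheme \<Rightarrow> bool" where
  "left_goldie_ring R \<longleftrightarrow> ring R \<and> finite_left_uniform_dim R \<and> acc_left_annihilators R"


section \<open>Ore extensions\<close>

definition skew_derivation ::
  "('a, 'm) ring_scheme \<Rightarrow> ('a \<Rightarrow> 'a) \<Rightarrow> ('a \<Rightarrow> 'a) \<Rightarrow> bool" where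
  "skew_derivation R \<sigma> \<delta> \<longleftrightarrow>
     \<delta> \<in> carrier R \<rightarrow> carrier R \<and>
     (\<forall>a\<in>carrier R. \<forall>b\<in>carrier R. \<delta> (a \<oplus>\<^bsub>R\<^esub> b) = \<delta> a \<oplus>\<^bsub>R\<^esub> \<delta> b) \<and>
     (\<forall>a\<in>carrier R. \<forall>b\<in>carrier R. \<delta> (a \<otimes>\<^bsub>R\<^esub> b) = \<sigma> a \<otimes>\<^bsub>R\<^esub> \<delta> b \<oplus>\<^bsub>R\<^esub> \<delta> a \<otimes>\<^bsub>R\<^esub> b)"

text \<open>
  Left multiplication by \<open>x\<close> on coefficient sequences: the rule \<open>x r = \<sigma>(r) x + \<delta>(r)\<close> forces
  \<open>x (\<Sum> g\<^sub>i x\<^sup>i) = \<Sum> \<sigma>(g\<^sub>i) x\<^sup>i\<^sup>+\<^sup>1 + \<Sum> \<delta>(g\<^sub>i) x\<^sup>i\<close>.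
\<close>

definition ore_shift ::
  "('a, 'm) ring_scheme \<Rightarrow> ('a \<Rightarrow> 'a) \<Rightarrow> ('a \<Rightarrow> 'a) \<Rightarrow> (nat \<Rightarrow> 'a) \<Rightarrow> nat \<Rightarrow> 'a" where
  "ore_shift R \<sigma> \<delta> g n = (case n of 0 \<Rightarrow> \<zero>\<^bsub>R\<^esub> | Suc m \<Rightarrow> \<sigma> (g m)) \<oplus>\<^bsub>R\<^esub> \<delta> (g n)"

text \<open>
  The additive group, the unity and the left \<open>R\<close>-module structure of \<open>R[x;\<sigma>,\<delta>]\<close> are those of
  the ordinary polynomials \<^term>\<open>UP R\<close>, coefficients being written on the left; the product is
  \<open>(\<Sum> f\<^sub>i x\<^sup>i) g = \<Sum> f\<^sub>i (x\<^sup>i g)\<close>. The lemmas below show that this is a ring in which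
  \<open>x r = \<sigma>(r) x + \<delta>(r)\<close> and whose elements are the sums \<open>\<Sum> f\<^sub>i x\<^sup>i\<close>.
\<close>

definition ore_extension ::
  "('a, 'm) ring_scheme \<Rightarrow> ('a \<Rightarrow> 'a) \<Rightarrow> ('a \<Rightarrow> 'a) \<Rightarrow> ('a, nat \<Rightarrow> 'a) up_ring" where
  "ore_extension R \<sigma> \<delta> = (UP R)\<lparr>mult :=
     (\<lambda>f g n. \<Oplus>\<^bsub>R\<^esub>i \<in> {i. f i \<noteq> \<zero>\<^bsub>R\<^esub>}. f i \<otimes>\<^bsub>R\<^esub> (ore_shift R \<sigma> \<delta> ^^ i) g n)\<rparr>"

locale ore = ring R for R (structure) +
  fixes \<sigma> \<delta> :: "'a \<Rightarrow> 'a"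
  assumes sigma_hom: "\<sigma> \<in> ring_hom R R"
    and delta_der: "skew_derivation R \<sigma> \<delta>"
begin

abbreviation Ore where "Ore \<equiv> ore_extension R \<sigma> \<delta>"
abbreviation shift where "shift \<equiv> ore_shift R \<sigma> \<delta>"

lemma sigma_closed [simp]: "a \<in> carrier R \<Longrightarrow> \<sigma> a \<in> carrier R"
  using sigma_hom by (rule ring_hom_closed)

lemma sigma_simps [simp]:
  "\<lbrakk>a \<in> carrier R; b \<in> carrier R\<rbrakk> \<Longrightarrow> \<sigma> (a \<oplus> b) = \<sigma> a \<oplus> \<sigma> b"
  "\<lbrakk>a \<in> carrier R; b \<in> carrier R\<rbrakk> \<Longrightarrow> \<sigma> (a \<otimes> b) = \<sigma> a \<otimes> \<sigma> b"
  "\<sigma> \<one> = \<one>"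
  using sigma_hom by (auto simp: ring_hom_def)

lemma delta_closed [simp]: "a \<in> carrier R \<Longrightarrow> \<delta> a \<in> carrier R"
  using delta_der by (auto simp: skew_derivation_def)

lemma delta_simps [simp]:
  "\<lbrakk>a \<in> carrier R; b \<in> carrier R\<rbrakk> \<Longrightarrow> \<delta> (a \<oplus> b) = \<delta> a \<oplus> \<delta> b"
  "\<lbrakk>a \<in> carrier R; b \<in> carrier R\<rbrakk> \<Longrightarrow> \<delta> (a \<otimes> b) = \<sigma> a \<otimes> \<delta> b \<oplus> \<delta> a \<otimes> b"
  using delta_der by (auto simp: skew_derivation_def)

lemma sigma_zero [simp]: "\<sigma> \<zero> = \<zero>"
proof -
  have "\<sigma> \<zero> \<oplus> \<sigma> \<zero> = \<sigma> \<zero>"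
    using sigma_simps(1)[of \<zero> \<zero>] by simp
  then show ?thesis
    by (metis add.r_cancel_one sigma_closed zero_closed)
qed

lemma delta_zero [simp]: "\<delta> \<zero> = \<zero>"
proof -
  have "\<delta> \<zero> \<oplus> \<delta> \<zero> = \<delta> \<zero>"
    using delta_simps(1)[of \<zero> \<zero>] by simp
  then show ?thesis
    by (metis add.r_cancel_one delta_closed zero_closed)
qed

lemma delta_one [simp]: "\<delta> \<one> = \<zero>"
proof -
  have "\<delta> \<one> \<oplus> \<delta> \<one> = \<delta> \<one>"
    using delta_simps(2)[of \<one> \<one>] by simp
  then show ?thesis
    by (metis add.r_cancel_one delta_closed one_closed)
qed

lemma carrier_Ore: "carrier Ore = up R"
  and zero_Ore: "\<zero>\<^bsub>Ore\<^esub> = (\<lambda>_. \<zero>)"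
  and one_Ore: "\<one>\<^bsub>Ore\<^esub> = (\<lambda>i. if i = 0 then \<one> else \<zero>)"
  and add_Ore: "\<lbrakk>f \<in> up R; g \<in> up R\<rbrakk> \<Longrightarrow> f \<oplus>\<^bsub>Ore\<^esub> g = (\<lambda>n. f n \<oplus> g n)"
  and monom_Ore: "a \<in> carrier R \<Longrightarrow> monom Ore a k = (\<lambda>i. if i = k then a else \<zero>)"
  by (simp_all add: ore_extension_def UP_def)

lemma mult_Ore:
  "f \<otimes>\<^bsub>Ore\<^esub> g = (\<lambda>n. \<Oplus>i \<in> {i. f i \<noteq> \<zero>}. f i \<otimes> (shift ^^ i) g n)"
  by (simp add: ore_extension_def)

lemma up_monom: "a \<in> carrier R \<Longrightarrow> (\<lambda>i. if i = k then a else \<zero>) \<in> up R"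
  by (rule mem_upI) (auto intro!: exI[of _ k])

lemma up_zero: "(\<lambda>_. \<zero>) \<in> up R"
  by (rule mem_upI) auto

lemma shift_closed [simp]: "f \<in> up R \<Longrightarrow> shift f \<in> up R"
proof -
  assume f: "f \<in> up R"
  then obtain N where N: "bound \<zero> N f" by auto
  have "bound \<zero> (Suc N) (shift f)"
    using bound.bound[OF N] by (auto simp: ore_shift_def split: nat.split)
  moreover have "shift f n \<in> carrier R" for n
    using mem_upD[OF f] by (auto simp: ore_shift_def split: nat.split)
  ultimately show ?thesis by blast
qed

lemma shift_pow_closed [simp]: "f \<in> up R \<Longrightarrow> (shift ^^ i) f \<in> up R"
  by (induction i) auto

lemma shift_add:
  assumes "f \<in> up R" "g \<in> up R"
  shows "shift (\<lambda>n. f n \<oplus> g n) = (\<lambda>n. shift f n \<oplus> shift g n)"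
  using mem_upD[OF assms(1)] mem_upD[OF assms(2)]
  by (auto simp: ore_shift_def a_ac split: nat.split)

lemma shift_pow_add:
  assumes "f \<in> up R" "g \<in> up R"
  shows "(shift ^^ i) (\<lambda>n. f n \<oplus> g n) = (\<lambda>n. (shift ^^ i) f n \<oplus> (shift ^^ i) g n)"
  using assms by (induction i) (simp_all add: shift_add)

lemma shift_smult:
  assumes "a \<in> carrier R" "f \<in> up R"
  shows "shift (\<lambda>n. a \<otimes> f n) = (\<lambda>n. \<sigma> a \<otimes> shift f n \<oplus> \<delta> a \<otimes> f n)"
  using assms(1) mem_upD[OF assms(2)]
  by (auto simp: ore_shift_def a_ac r_distr split: nat.split)

lemma shift_monom:
  assumes "a \<in> carrier R"
  shows "shift (\<lambda>i. if i = k then a else \<zero>)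
    = (\<lambda>n. (if n = Suc k then \<sigma> a else \<zero>) \<oplus> (if n = k then \<delta> a else \<zero>))"
  using assms by (auto simp: ore_shift_def split: nat.split)

lemma shift_pow_one:
  "(shift ^^ i) (\<lambda>n. if n = 0 then \<one> else \<zero>) = (\<lambda>n. if n = i then \<one> else \<zero>)"
proof (induction i)
  case (Suc i)
  then show ?case by (simp add: shift_monom) auto
qed simp

lemma mult_eq:
  assumes f: "f \<in> up R" and g: "g \<in> up R" and N: "bound \<zero> N f"
  shows "(f \<otimes>\<^bsub>Ore\<^esub> g) n = (\<Oplus>i \<in> {..N}. f i \<otimes> (shift ^^ i) g n)"
proof -
  have c: "f i \<in> carrier R" "(shift ^^ i) g n \<in> carrier R" for i
    using f g by (auto intro: mem_upD)
  have "{i. f i \<noteq> \<zero>} \<subseteq> {..N}"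
    using N bound_below by fastforce
  then show ?thesis
    unfolding mult_Ore using c
    by (intro add.finprod_mono_neutral_cong_left) auto
qed

lemma mult_monom:
  assumes a: "a \<in> carrier R" and g: "g \<in> up R"
  shows "(\<lambda>i. if i = k then a else \<zero>) \<otimes>\<^bsub>Ore\<^esub> g = (\<lambda>n. a \<otimes> (shift ^^ k) g n)"
proof
  fix n
  have c: "(shift ^^ i) g n \<in> carrier R" for i
    using g by (auto intro: mem_upD)
  have b: "bound \<zero> k (\<lambda>i. if i = k then a else \<zero>)" by auto
  have "((\<lambda>i. if i = k then a else \<zero>) \<otimes>\<^bsub>Ore\<^esub> g) n
      = (\<Oplus>i \<in> {..k}. (if i = k then a else \<zero>) \<otimes> (shift ^^ i) g n)"
    by (rule mult_eq[OF up_monom[OF a] g b])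
  also have "\<dots> = (\<Oplus>i \<in> {..k}. if k = i then a \<otimes> (shift ^^ i) g n else \<zero>)"
    using a c by (intro add.finprod_cong') auto
  also have "\<dots> = a \<otimes> (shift ^^ k) g n"
    using a c by (intro add.finprod_singleton) auto
  finally show "((\<lambda>i. if i = k then a else \<zero>) \<otimes>\<^bsub>Ore\<^esub> g) n = a \<otimes> (shift ^^ k) g n" .
qed

lemma mult_add_left:
  assumes f: "f \<in> up R" and g: "g \<in> up R" and h: "h \<in> up R"
  shows "(\<lambda>n. f n \<oplus> g n) \<otimes>\<^bsub>Ore\<^esub> h = (\<lambda>n. (f \<otimes>\<^bsub>Ore\<^esub> h) n \<oplus> (g \<otimes>\<^bsub>Ore\<^esub> h) n)"
proof
  fix n
  obtain N M where "bound \<zero> N f" "bound \<zero> M g" using f g by blast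
  then have b: "bound \<zero> (max N M) f" "bound \<zero> (max N M) g"
      "bound \<zero> (max N M) (\<lambda>n. f n \<oplus> g n)"
    by (auto simp: bound_def)
  have c: "f i \<in> carrier R" "g i \<in> carrier R" "(shift ^^ i) h n \<in> carrier R" for i
    using f g h by (auto intro: mem_upD)
  show "((\<lambda>n. f n \<oplus> g n) \<otimes>\<^bsub>Ore\<^esub> h) n = (f \<otimes>\<^bsub>Ore\<^esub> h) n \<oplus> (g \<otimes>\<^bsub>Ore\<^esub> h) n"
    using c by (simp add: mult_eq[OF f h b(1)] mult_eq[OF g h b(2)]
        mult_eq[OF up_add_closed[OF f g] h b(3)] l_distr finsum_addf)
qed

lemma mult_add_right:
  assumes f: "f \<in> up R" and g: "g \<in> up R" and h: "h \<in> up R"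
  shows "f \<otimes>\<^bsub>Ore\<^esub> (\<lambda>n. g n \<oplus> h n) = (\<lambda>n. (f \<otimes>\<^bsub>Ore\<^esub> g) n \<oplus> (f \<otimes>\<^bsub>Ore\<^esub> h) n)"
proof
  fix n
  obtain N where b: "bound \<zero> N f" using f by blast
  have c: "f i \<in> carrier R" "(shift ^^ i) g n \<in> carrier R" "(shift ^^ i) h n \<in> carrier R" for i
    using f g h by (auto intro: mem_upD)
  show "(f \<otimes>\<^bsub>Ore\<^esub> (\<lambda>n. g n \<oplus> h n)) n = (f \<otimes>\<^bsub>Ore\<^esub> g) n \<oplus> (f \<otimes>\<^bsub>Ore\<^esub> h) n"
    using c by (simp add: mult_eq[OF f g b] mult_eq[OF f h b]
        mult_eq[OF f up_add_closed[OF g h] b] shift_pow_add[OF g h] r_distr finsum_addf)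
qed

lemma mult_zero_left: "(\<lambda>_. \<zero>) \<otimes>\<^bsub>Ore\<^esub> g = (\<lambda>_. \<zero>)"
  by (simp add: mult_Ore)

lemma up_induct [consumes 1, case_names zero add]:
  assumes "f \<in> up R"
    and zero: "P (\<lambda>_. \<zero>)"
    and add: "\<And>f a k. \<lbrakk>f \<in> up R; P f; a \<in> carrier R\<rbrakk>
      \<Longrightarrow> P (\<lambda>n. f n \<oplus> (if n = k then a else \<zero>))"
  shows "P f"
proof -
  have "P f" if "f \<in> up R" "\<forall>m\<ge>N. f m = \<zero>" for N f
    using that
  proof (induction N arbitrary: f)
    case 0
    then have "f = (\<lambda>_. \<zero>)" by auto
    then show ?case using zero by simp
  next
    case (Suc N)
    let ?g = "\<lambda>n. if n = N then \<zero> else f n"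
    obtain M where "bound \<zero> M f" using Suc.prems by blast
    then have "?g \<in> up R"
      using mem_upD[OF Suc.prems(1)] by (intro mem_upI exI[of _ M]) (auto simp: bound_def)
    moreover have "\<forall>m\<ge>N. ?g m = \<zero>"
      using Suc.prems(2) by (metis Suc_leI le_neq_implies_less)
    ultimately have "P ?g" "?g \<in> up R" using Suc.IH by auto
    moreover have "f = (\<lambda>n. ?g n \<oplus> (if n = N then f N else \<zero>))"
      using mem_upD[OF Suc.prems(1)] by auto
    ultimately show ?case
      using add[of ?g "f N" N] mem_upD[OF Suc.prems(1)] by simp
  qed
  moreover obtain N where "bound \<zero> N f" using assms(1) by blast
  then have "\<forall>m\<ge>Suc N. f m = \<zero>" by (auto simp: bound_def Suc_le_eq)
  ultimately show ?thesis using assms(1) by blast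
qed

lemma mult_closed: "\<lbrakk>f \<in> up R; g \<in> up R\<rbrakk> \<Longrightarrow> f \<otimes>\<^bsub>Ore\<^esub> g \<in> up R"
proof (induction f rule: up_induct)
  case zero
  then show ?case by (simp add: mult_zero_left up_zero)
next
  case (add f a k)
  then show ?case
    by (simp add: mult_add_left up_monom mult_monom up_add_closed up_smult_closed)
qed

lemma mult_smult_left:
  assumes a: "a \<in> carrier R" and f: "f \<in> up R" and g: "g \<in> up R"
  shows "(\<lambda>n. a \<otimes> f n) \<otimes>\<^bsub>Ore\<^esub> g = (\<lambda>n. a \<otimes> (f \<otimes>\<^bsub>Ore\<^esub> g) n)"
proof
  fix n
  obtain N where b: "bound \<zero> N f" using f by blast
  then have b': "bound \<zero> N (\<lambda>n. a \<otimes> f n)" using a by (auto simp: bound_def)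
  have c: "f i \<in> carrier R" "(shift ^^ i) g n \<in> carrier R" for i
    using f g by (auto intro: mem_upD)
  show "((\<lambda>n. a \<otimes> f n) \<otimes>\<^bsub>Ore\<^esub> g) n = a \<otimes> (f \<otimes>\<^bsub>Ore\<^esub> g) n"
    using a c by (simp add: mult_eq[OF f g b] mult_eq[OF up_smult_closed[OF a f] g b']
        finsum_rdistr m_assoc)
qed

lemma mult_shift:
  assumes g: "g \<in> up R" and h: "h \<in> up R"
  shows "shift g \<otimes>\<^bsub>Ore\<^esub> h = shift (g \<otimes>\<^bsub>Ore\<^esub> h)"
  using g
proof (induction g rule: up_induct)
  case zero
  have "shift (\<lambda>_. \<zero>) = (\<lambda>_. \<zero>)"
    by (auto simp: ore_shift_def split: nat.split)
  then show ?case by (simp add: mult_zero_left)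
next
  case (add f a k)
  let ?m = "\<lambda>n. if n = k then a else \<zero>"
  have "shift ?m \<otimes>\<^bsub>Ore\<^esub> h = shift (?m \<otimes>\<^bsub>Ore\<^esub> h)"
    using add h by (simp add: shift_monom mult_add_left up_monom mult_monom shift_smult)
  then show ?case
    using add h by (simp add: shift_add mult_add_left up_monom mult_closed)
qed

lemma mult_shift_pow:
  assumes "g \<in> up R" "h \<in> up R"
  shows "(shift ^^ k) g \<otimes>\<^bsub>Ore\<^esub> h = (shift ^^ k) (g \<otimes>\<^bsub>Ore\<^esub> h)"
  using assms by (induction k) (simp_all add: mult_shift)

lemma mult_assoc:
  assumes f: "f \<in> up R" and g: "g \<in> up R" and h: "h \<in> up R"
  shows "(f \<otimes>\<^bsub>Ore\<^esub> g) \<otimes>\<^bsub>Ore\<^esub> h = f \<otimes>\<^bsub>Ore\<^esub> (g \<otimes>\<^bsub>Ore\<^esub> h)"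
  using f
proof (induction f rule: up_induct)
  case zero
  then show ?case by (simp add: mult_zero_left)
next
  case (add f a k)
  then show ?case
    using g h by (simp add: mult_add_left up_monom mult_monom mult_closed up_smult_closed
        mult_smult_left mult_shift_pow)
qed

lemma mult_one_left:
  assumes "g \<in> up R"
  shows "\<one>\<^bsub>Ore\<^esub> \<otimes>\<^bsub>Ore\<^esub> g = g"
  using mult_monom[OF one_closed assms, of 0] mem_upD[OF assms] by (simp add: one_Ore)

lemma mult_one_right:
  assumes "f \<in> up R"
  shows "f \<otimes>\<^bsub>Ore\<^esub> \<one>\<^bsub>Ore\<^esub> = f"
  using assms
proof (induction f rule: up_induct)
  case zero
  then show ?case by (simp add: mult_zero_left)
next
  case (add f a k)
  have "(\<lambda>n. if n = k then a else \<zero>) \<otimes>\<^bsub>Ore\<^esub> \<one>\<^bsub>Ore\<^esub> = (\<lambda>n. if n = k then a else \<zero>)"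
    using add up_one_closed by (auto simp: one_Ore mult_monom shift_pow_one)
  then show ?case
    using add up_one_closed by (simp add: mult_add_left up_monom one_Ore)
qed

lemma ring_Ore: "ring Ore"
proof (rule ringI)
  interpret U: UP_ring R "UP R"
    by unfold_locales simp
  have "add_monoid Ore = add_monoid (UP R)"
    by (simp add: ore_extension_def)
  then show "abelian_group Ore"
    using ring.is_abelian_group[OF U.UP_ring]
    by (simp add: abelian_group_def abelian_monoid_def abelian_group_axioms_def)
  show "monoid Ore"
    by (rule monoidI)
      (simp_all add: carrier_Ore mult_closed mult_assoc mult_one_left mult_one_right
         up_one_closed one_Ore[symmetric], simp add: one_Ore up_one_closed)
qed (simp_all add: carrier_Ore add_Ore mult_add_left mult_add_right mult_closed)

theorem ore_commutation:
  assumes "r \<in> carrier R"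
  shows "monom Ore \<one> 1 \<otimes>\<^bsub>Ore\<^esub> monom Ore r 0
    = monom Ore (\<sigma> r) 0 \<otimes>\<^bsub>Ore\<^esub> monom Ore \<one> 1 \<oplus>\<^bsub>Ore\<^esub> monom Ore (\<delta> r) 0"
  using assms mem_upD[OF shift_closed[OF up_monom[OF assms, of 0]]]
  by (auto simp: monom_Ore mult_monom up_monom shift_monom add_Ore up_smult_closed)

theorem ore_coefficients_hom: "(\<lambda>r. monom Ore r 0) \<in> ring_hom R Ore"
  by (rule ring_hom_memI)
    (auto simp: carrier_Ore monom_Ore mult_monom up_monom add_Ore one_Ore)

lemma ore_x_pow: "monom Ore \<one> 1 [^]\<^bsub>Ore\<^esub> (k::nat) = monom Ore \<one> k"
proof -
  interpret S: ring Ore by (rule ring_Ore)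
  show ?thesis
  proof (induction k)
    case 0
    then show ?case by (simp add: monom_Ore one_Ore)
  next
    case (Suc k)
    have x: "monom Ore \<one> 1 \<in> carrier Ore"
      by (simp add: carrier_Ore monom_Ore up_monom)
    have "monom Ore \<one> 1 [^]\<^bsub>Ore\<^esub> Suc k = monom Ore \<one> 1 \<otimes>\<^bsub>Ore\<^esub> monom Ore \<one> k"
      unfolding S.nat_pow_Suc2[OF x] Suc.IH ..
    also have "\<dots> = monom Ore \<one> (Suc k)"
      by (auto simp: monom_Ore mult_monom up_monom shift_monom)
    finally show ?case .
  qed
qed

theorem ore_normal_form:
  assumes f: "f \<in> carrier Ore" and N: "bound \<zero> N f"
  shows "f = (\<Oplus>\<^bsub>Ore\<^esub>i \<in> {..N}. monom Ore (f i) 0 \<otimes>\<^bsub>Ore\<^esub> monom Ore \<one> 1 [^]\<^bsub>Ore\<^esub> i)"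
proof -
  interpret S: ring Ore by (rule ring_Ore)
  have c: "f i \<in> carrier R" for i using f by (auto simp: carrier_Ore)
  have m: "monom Ore (f i) 0 \<otimes>\<^bsub>Ore\<^esub> monom Ore \<one> 1 [^]\<^bsub>Ore\<^esub> i = (\<lambda>n. if n = i then f i else \<zero>)" for i
    unfolding ore_x_pow using c by (auto simp: monom_Ore mult_monom up_monom)
  have "(\<Oplus>\<^bsub>Ore\<^esub>i \<in> {..M}. (\<lambda>n. if n = i then f i else \<zero>)) = (\<lambda>n. if n \<le> M then f n else \<zero>)" for M
  proof (induction M)
    case 0
    then show ?case using c by (auto simp: carrier_Ore up_monom)
  next
    case (Suc M)
    have "(\<lambda>n. if n \<le> M then f n else \<zero>) \<in> up R"
      using c by (intro mem_upI exI[of _ M]) auto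
    then show ?case
      using Suc c by (subst S.finsum_Suc) (auto simp: carrier_Ore up_monom add_Ore le_Suc_eq)
  qed
  then have "(\<Oplus>\<^bsub>Ore\<^esub>i \<in> {..N}. monom Ore (f i) 0 \<otimes>\<^bsub>Ore\<^esub> monom Ore \<one> 1 [^]\<^bsub>Ore\<^esub> i)
      = (\<lambda>n. if n \<le> N then f n else \<zero>)"
    by (simp only: m)
  also have "\<dots> = f"
    using N by (auto simp: bound_def)
  finally show ?thesis by simp
qed

end

end

theory Submission
  imports Defs
begin

text \<open>
  The ring \<open>R\<close> is left nonsingular. Say that an element of a torsion-free left \<open>R\<close>-module lies in
  the closure of a submodule \<open>N\<close> if an essential left ideal multiplies it into \<open>N\<close>; then chains of
  submodules that are strict up to closure are bounded by the uniform dimension. If \<open>R\<close> has uniform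
  dimension \<open>n\<close>, the polynomials of degree at most \<open>m\<close> in \<open>S = R[x;\<sigma>,\<delta>]\<close> have dimension
  \<open>(m + 1) n\<close>. Since \<open>\<sigma>\<close> is injective, a nonzero left ideal of \<open>S\<close> has dimension at least
  \<open>m - O(1)\<close> in these degrees. Comparing growth rates in \<open>m\<close> shows that neither a direct sum of
  nonzero left ideals of \<open>S\<close> nor a strict chain of left annihilators of \<open>S\<close> has more than \<open>n\<close> steps.
  If \<open>f S f = 0\<close> with \<open>f \<noteq> 0\<close>, the iterates of \<open>\<sigma>\<close> on a multiple of the leading coefficient would
  generate an infinite direct sum of left ideals of \<open>R\<close>.
\<close>

section \<open>Essential left ideals and closures of submodules\<close>

text \<open>Nonsingularity makes closure behave like the span in a matroid: an essential left ideal
  cannot annihilate a nonzero element of \<open>R\<close>, so closures are idempotent and Steinitz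
  exchange works. The chain condition on left annihilators of \<open>R\<close> enters the proof
  through this property. The obstacle in \<open>S\<close> is that degrees alone do not show how a
  left ideal \<open>B\<close> exceeds a smaller \<open>A\<close>: both may have elements of the same
  degrees, and \<open>R\<close> may have zero divisors. So a homomorphism that kills
  \<open>A\<close> is followed instead. If \<open>f\<close> in \<open>B\<close> has the nonzero
  image \<open>g\<close>, then \<open>x^l f\<close> has the image \<open>x^l g\<close>, whose degree
  grows by exactly one with each \<open>l\<close>, since its leading coefficient is a power of
  \<open>\<sigma>\<close> applied to that of \<open>g\<close>. This gives one dimension per degree,
  up to a constant that depends on the step. Therefore a finite number of steps is fixed first and
  the degree bound \<open>m\<close> is chosen after it.\<close>

definition (in ring) left_essential :: "'a set \<Rightarrow> bool" where
  "left_essential L \<longleftrightarrow> (\<forall>b\<in>carrier R. b \<noteq> \<zero> \<longrightarrow> (\<exists>c\<in>carrier R. c \<otimes> b \<in> L \<and> c \<otimes> b \<noteq> \<zero>))"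

lemma (in ring) left_essential_mono: "\<lbrakk>left_essential L; L \<subseteq> L'\<rbrakk> \<Longrightarrow> left_essential L'"
  unfolding left_essential_def by (meson subsetD)

text \<open>Multiply into \<open>L\<close> first and into \<open>L'\<close> afterwards: the second
  multiplication does not leave \<open>L\<close>. This explains the asymmetric hypotheses.\<close>

lemma (in ring) left_essential_Int:
  assumes L: "left_essential L" "\<And>r a. \<lbrakk>r \<in> carrier R; a \<in> L\<rbrakk> \<Longrightarrow> r \<otimes> a \<in> L"
    and L': "left_essential L'"
  shows "left_essential (L \<inter> L')"
  unfolding left_essential_def
proof (intro ballI impI)
  fix b assume b: "b \<in> carrier R" "b \<noteq> \<zero>"
  obtain c where c: "c \<in> carrier R" "c \<otimes> b \<in> L" "c \<otimes> b \<noteq> \<zero>"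
    using L(1) b unfolding left_essential_def by blast
  moreover obtain d where "d \<in> carrier R" "d \<otimes> (c \<otimes> b) \<in> L'" "d \<otimes> (c \<otimes> b) \<noteq> \<zero>"
    using L' b(1) c unfolding left_essential_def by (meson m_closed)
  ultimately show "\<exists>c\<in>carrier R. c \<otimes> b \<in> L \<inter> L' \<and> c \<otimes> b \<noteq> \<zero>"
    using L(2) b(1) by (intro bexI[of _ "d \<otimes> c"]) (auto simp: m_assoc)
qed

text \<open>That is, the left singular ideal of \<open>R\<close> is zero.\<close>

definition (in ring) left_nonsingular :: bool where
  "left_nonsingular \<longleftrightarrow> (\<forall>a\<in>carrier R. left_essential {r \<in> carrier R. r \<otimes> a = \<zero>} \<longrightarrow> a = \<zero>)"

section \<open>Left modules and the closure of a submodule\<close>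

locale left_module = ring R + M: abelian_group M for R (structure) and M (structure) +
  fixes smult :: "'a \<Rightarrow> 'c \<Rightarrow> 'c" (infixr "\<bullet>" 75)
  assumes smult_closed [simp]: "\<lbrakk>a \<in> carrier R; v \<in> carrier M\<rbrakk> \<Longrightarrow> a \<bullet> v \<in> carrier M"
    and smult_l_distr: "\<lbrakk>a \<in> carrier R; b \<in> carrier R; v \<in> carrier M\<rbrakk>
      \<Longrightarrow> (a \<oplus> b) \<bullet> v = a \<bullet> v \<oplus>\<^bsub>M\<^esub> b \<bullet> v"
    and smult_r_distr: "\<lbrakk>a \<in> carrier R; v \<in> carrier M; w \<in> carrier M\<rbrakk>
      \<Longrightarrow> a \<bullet> (v \<oplus>\<^bsub>M\<^esub> w) = a \<bullet> v \<oplus>\<^bsub>M\<^esub> a \<bullet> w"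
    and smult_assoc: "\<lbrakk>a \<in> carrier R; b \<in> carrier R; v \<in> carrier M\<rbrakk>
      \<Longrightarrow> (a \<otimes> b) \<bullet> v = a \<bullet> b \<bullet> v"
    and smult_one [simp]: "v \<in> carrier M \<Longrightarrow> \<one> \<bullet> v = v"
begin

lemma smult_zero_left [simp]:
  assumes "v \<in> carrier M"
  shows "\<zero> \<bullet> v = \<zero>\<^bsub>M\<^esub>"
proof -
  have "\<zero> \<bullet> v \<oplus>\<^bsub>M\<^esub> \<zero> \<bullet> v = \<zero> \<bullet> v"
    using smult_l_distr[of \<zero> \<zero> v] assms by simp
  then show ?thesis
    using assms by (simp add: M.add.l_cancel_one)
qed

lemma smult_zero_right [simp]:
  assumes "a \<in> carrier R"
  shows "a \<bullet> \<zero>\<^bsub>M\<^esub> = \<zero>\<^bsub>M\<^esub>"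
proof -
  have "a \<bullet> \<zero>\<^bsub>M\<^esub> \<oplus>\<^bsub>M\<^esub> a \<bullet> \<zero>\<^bsub>M\<^esub> = a \<bullet> \<zero>\<^bsub>M\<^esub>"
    using smult_r_distr[of a "\<zero>\<^bsub>M\<^esub>" "\<zero>\<^bsub>M\<^esub>"] assms by simp
  then show ?thesis
    using assms by (simp add: M.add.l_cancel_one)
qed

lemma smult_minus_one:
  assumes "v \<in> carrier M"
  shows "(\<ominus> \<one>) \<bullet> v = \<ominus>\<^bsub>M\<^esub> v"
proof -
  have "(\<ominus> \<one>) \<bullet> v \<oplus>\<^bsub>M\<^esub> v = \<zero>\<^bsub>M\<^esub>"
    using smult_l_distr[of "\<ominus> \<one>" \<one> v] assms by (simp add: l_neg)
  then show ?thesis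
    using assms by (simp add: M.minus_equality)
qed

definition submod :: "'c set \<Rightarrow> bool" where
  "submod N \<longleftrightarrow> N \<subseteq> carrier M \<and> \<zero>\<^bsub>M\<^esub> \<in> N \<and> (\<forall>v\<in>N. \<forall>w\<in>N. v \<oplus>\<^bsub>M\<^esub> w \<in> N) \<and>
     (\<forall>a\<in>carrier R. \<forall>v\<in>N. a \<bullet> v \<in> N)"

lemma submodD:
  assumes "submod N"
  shows "v \<in> N \<Longrightarrow> v \<in> carrier M" "\<zero>\<^bsub>M\<^esub> \<in> N" "\<lbrakk>v \<in> N; w \<in> N\<rbrakk> \<Longrightarrow> v \<oplus>\<^bsub>M\<^esub> w \<in> N"
    "\<lbrakk>a \<in> carrier R; v \<in> N\<rbrakk> \<Longrightarrow> a \<bullet> v \<in> N"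
  using assms unfolding submod_def by auto

lemma submod_minus: "\<lbrakk>submod N; v \<in> N\<rbrakk> \<Longrightarrow> \<ominus>\<^bsub>M\<^esub> v \<in> N"
  using submodD(4)[of N "\<ominus> \<one>" v] submodD(1)[of N v] by (simp add: smult_minus_one)

lemma submod_add_cancel:
  assumes N: "submod N" and "n \<in> N" "n \<oplus>\<^bsub>M\<^esub> v \<in> N" "v \<in> carrier M"
  shows "v \<in> N"
proof -
  have "\<ominus>\<^bsub>M\<^esub> n \<oplus>\<^bsub>M\<^esub> (n \<oplus>\<^bsub>M\<^esub> v) = v"
    using assms submodD(1)[OF N] by (simp add: M.r_neg1)
  then show ?thesis
    using submodD(3)[OF N submod_minus[OF N]] assms by metis
qed

lemma submod_finsum:
  assumes N: "submod N" and f: "\<And>i. i \<in> A \<Longrightarrow> f i \<in> N"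
  shows "finsum M f A \<in> N"
proof (cases "finite A")
  case True
  then show ?thesis
    using f
  proof (induction A)
    case (insert a A)
    then show ?case
      using submodD(1,3)[OF N] by (subst M.finsum_insert) (auto simp: Pi_iff)
  qed (simp add: submodD[OF N])
qed (simp add: M.finsum_infinite submodD[OF N])

lemma submod_zero: "submod {\<zero>\<^bsub>M\<^esub>}"
  by (simp add: submod_def)

text \<open>For a submodule \<open>N\<close> this is the preimage of the singular submodule of
  \<open>M/N\<close>.\<close>

definition closure :: "'c set \<Rightarrow> 'c set" where
  "closure N = {w \<in> carrier M. left_essential {r \<in> carrier R. r \<bullet> w \<in> N}}"

lemma closure_mono: "N \<subseteq> N' \<Longrightarrow> closure N \<subseteq> closure N'"
  unfolding closure_def by (auto intro: left_essential_mono)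

lemma closure_subset:
  assumes "submod N"
  shows "N \<subseteq> closure N"
proof
  fix w assume w: "w \<in> N"
  then have "{r \<in> carrier R. r \<bullet> w \<in> N} = carrier R"
    using submodD[OF assms] by auto
  then show "w \<in> closure N"
    using submodD(1)[OF assms w] unfolding closure_def left_essential_def
    by (auto intro!: bexI[of _ \<one>])
qed

lemma closure_smult:
  assumes N: "submod N" and w: "w \<in> closure N" and a: "a \<in> carrier R"
  shows "a \<bullet> w \<in> closure N"
proof -
  have w': "w \<in> carrier M" "left_essential {r \<in> carrier R. r \<bullet> w \<in> N}"
    using w by (auto simp: closure_def)
  have "\<exists>c\<in>carrier R. c \<otimes> b \<in> {r \<in> carrier R. r \<bullet> a \<bullet> w \<in> N} \<and> c \<otimes> b \<noteq> \<zero>"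
    if b: "b \<in> carrier R" "b \<noteq> \<zero>" for b
  \<comment> \<open>If \<open>b\<close> kills \<open>a\<close>, then \<open>b\<close> itself
    multiplies \<open>a \<bullet> w\<close> into \<open>N\<close>; otherwise essentiality for
    \<open>w\<close> is applied to \<open>b \<otimes> a\<close>.\<close>
  proof (cases "b \<otimes> a = \<zero>")
    case True
    then have "b \<bullet> a \<bullet> w = \<zero>\<^bsub>M\<^esub>"
      using a b w'(1) by (simp add: smult_assoc[symmetric])
    then show ?thesis
      using b submodD(2)[OF N] by (intro bexI[of _ \<one>]) auto
  next
    case False
    then obtain c where c: "c \<in> carrier R" "c \<otimes> (b \<otimes> a) \<noteq> \<zero>" "(c \<otimes> (b \<otimes> a)) \<bullet> w \<in> N"
      using w'(2) a b(1) unfolding left_essential_def by blast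
    then have "c \<otimes> b \<noteq> \<zero>"
      using a b by (metis l_null m_assoc)
    moreover have "(c \<otimes> b) \<bullet> a \<bullet> w \<in> N"
      using c a b w'(1) by (simp add: m_assoc smult_assoc)
    ultimately show ?thesis
      using b c by blast
  qed
  then show ?thesis
    using a w' by (simp add: closure_def left_essential_def)
qed

lemma closure_submod:
  assumes N: "submod N"
  shows "submod (closure N)"
  unfolding submod_def
proof (intro conjI ballI)
  show "closure N \<subseteq> carrier M"
    by (auto simp: closure_def)
  show "\<zero>\<^bsub>M\<^esub> \<in> closure N"
    using closure_subset[OF N] submodD(2)[OF N] by auto
  show "a \<bullet> v \<in> closure N" if "a \<in> carrier R" "v \<in> closure N" for a v
    by (rule closure_smult[OF N that(2,1)])
  fix v w assume vw: "v \<in> closure N" "w \<in> closure N"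
  let ?C = "\<lambda>v. {r \<in> carrier R. r \<bullet> v \<in> N}"
  have "left_essential (?C v \<inter> ?C w)"
    using vw submodD(4)[OF N]
    by (intro left_essential_Int) (auto simp: closure_def smult_assoc)
  moreover have "?C v \<inter> ?C w \<subseteq> ?C (v \<oplus>\<^bsub>M\<^esub> w)"
    using vw submodD(3)[OF N] by (auto simp: closure_def smult_r_distr)
  ultimately show "v \<oplus>\<^bsub>M\<^esub> w \<in> closure N"
    using vw left_essential_mono by (auto simp: closure_def)
qed

text \<open>The left ideal of all \<open>r\<close> with \<open>r \<bullet> w\<close> in
  \<open>N\<close> misses a nonzero cyclic left ideal, generated by \<open>b\<close>; then
  \<open>b \<bullet> w\<close> generates a submodule independent of \<open>N\<close>. This turns
  strictness up to closure into directness of sums.\<close>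

lemma not_in_closureE:
  assumes N: "submod N" and w: "w \<in> carrier M" "w \<notin> closure N"
  obtains b where "b \<in> carrier R" "b \<bullet> w \<noteq> \<zero>\<^bsub>M\<^esub>"
    "\<And>r. \<lbrakk>r \<in> carrier R; r \<bullet> b \<bullet> w \<in> N\<rbrakk> \<Longrightarrow> r \<bullet> b \<bullet> w = \<zero>\<^bsub>M\<^esub>"
proof -
  obtain b where b: "b \<in> carrier R" "b \<noteq> \<zero>"
    and *: "\<And>c. \<lbrakk>c \<in> carrier R; (c \<otimes> b) \<bullet> w \<in> N\<rbrakk> \<Longrightarrow> c \<otimes> b = \<zero>"
    using w unfolding closure_def left_essential_def by auto
  have "b \<bullet> w \<noteq> \<zero>\<^bsub>M\<^esub>"
    using *[of \<one>] b submodD(2)[OF N] by auto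
  moreover have "r \<bullet> b \<bullet> w = \<zero>\<^bsub>M\<^esub>" if "r \<in> carrier R" "r \<bullet> b \<bullet> w \<in> N" for r
    using *[of r] that b w by (metis smult_assoc smult_zero_left)
  ultimately show thesis
    using that b by blast
qed

definition uniform :: "'c \<Rightarrow> bool" where
  "uniform u \<longleftrightarrow> u \<in> carrier M \<and> (\<forall>r\<in>carrier R. \<forall>s\<in>carrier R. r \<bullet> u \<noteq> \<zero>\<^bsub>M\<^esub> \<longrightarrow> s \<bullet> u \<noteq> \<zero>\<^bsub>M\<^esub> \<longrightarrow>
     (\<exists>a\<in>carrier R. \<exists>b\<in>carrier R. a \<bullet> r \<bullet> u = b \<bullet> s \<bullet> u \<and> a \<bullet> r \<bullet> u \<noteq> \<zero>\<^bsub>M\<^esub>))"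

text \<open>A nonzero submodule of a uniform module is essential in it, and essentiality pulls back
  along \<open>r \<mapsto> r \<bullet> u\<close>. In the contrapositive: a uniform \<open>u\<close>
  outside the closure of \<open>N\<close> is independent of \<open>N\<close>.\<close>

lemma uniform_in_closure:
  assumes N: "submod N" and u: "uniform u" and r: "r \<in> carrier R" "r \<bullet> u \<in> N" "r \<bullet> u \<noteq> \<zero>\<^bsub>M\<^esub>"
  shows "u \<in> closure N"
proof -
  have uM: "u \<in> carrier M" using u by (simp add: uniform_def)
  have "\<exists>c\<in>carrier R. (c \<otimes> b) \<bullet> u \<in> N \<and> c \<otimes> b \<noteq> \<zero>" if b: "b \<in> carrier R" "b \<noteq> \<zero>" for b
  proof (cases "b \<bullet> u = \<zero>\<^bsub>M\<^esub>")
    case True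
    then show ?thesis
      using b submodD(2)[OF N] by (intro bexI[of _ \<one>]) auto
  next
    case False
    then obtain a d where ad: "a \<in> carrier R" "d \<in> carrier R" "a \<bullet> b \<bullet> u = d \<bullet> r \<bullet> u"
      "a \<bullet> b \<bullet> u \<noteq> \<zero>\<^bsub>M\<^esub>"
      using u r(1,3) b(1) unfolding uniform_def by blast
    then have "(a \<otimes> b) \<bullet> u \<in> N"
      using submodD(4)[OF N] r(2) uM b by (simp add: smult_assoc)
    moreover have "a \<otimes> b \<noteq> \<zero>"
      using ad uM b by (metis smult_assoc smult_zero_left)
    ultimately show ?thesis
      using ad by blast
  qed
  then show ?thesis
    using uM by (simp add: closure_def left_essential_def)
qed

definition add_cyclic :: "'c set \<Rightarrow> 'c \<Rightarrow> 'c set" where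
  "add_cyclic N u = {n \<oplus>\<^bsub>M\<^esub> r \<bullet> u | n r. n \<in> N \<and> r \<in> carrier R}"

lemma add_cyclic_submod:
  assumes N: "submod N" and u: "u \<in> carrier M"
  shows "submod (add_cyclic N u)"
  unfolding submod_def
proof (intro conjI ballI)
  show "add_cyclic N u \<subseteq> carrier M"
    using submodD(1)[OF N] u by (auto simp: add_cyclic_def)
  show "\<zero>\<^bsub>M\<^esub> \<in> add_cyclic N u"
    using submodD(2)[OF N] u unfolding add_cyclic_def
    by (intro CollectI exI[of _ "\<zero>\<^bsub>M\<^esub>"] exI[of _ \<zero>]) auto
next
  fix v w assume "v \<in> add_cyclic N u" "w \<in> add_cyclic N u"
  then obtain n r n' r' where v: "n \<in> N" "r \<in> carrier R" "v = n \<oplus>\<^bsub>M\<^esub> r \<bullet> u"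
    and w: "n' \<in> N" "r' \<in> carrier R" "w = n' \<oplus>\<^bsub>M\<^esub> r' \<bullet> u"
    unfolding add_cyclic_def by blast
  have "v \<oplus>\<^bsub>M\<^esub> w = (n \<oplus>\<^bsub>M\<^esub> n') \<oplus>\<^bsub>M\<^esub> (r \<oplus> r') \<bullet> u"
    using v w u submodD(1)[OF N] by (simp add: smult_l_distr M.add.m_ac)
  then show "v \<oplus>\<^bsub>M\<^esub> w \<in> add_cyclic N u"
    using v w submodD(3)[OF N] unfolding add_cyclic_def by blast
next
  fix a v assume a: "a \<in> carrier R" and "v \<in> add_cyclic N u"
  then obtain n r where v: "n \<in> N" "r \<in> carrier R" "v = n \<oplus>\<^bsub>M\<^esub> r \<bullet> u"
    unfolding add_cyclic_def by blast
  have "a \<bullet> v = a \<bullet> n \<oplus>\<^bsub>M\<^esub> (a \<otimes> r) \<bullet> u"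
    using a v u submodD(1)[OF N] by (simp add: smult_r_distr smult_assoc)
  then show "a \<bullet> v \<in> add_cyclic N u"
    using a v submodD(4)[OF N] unfolding add_cyclic_def by blast
qed

lemma subset_add_cyclic:
  assumes N: "submod N" and u: "u \<in> carrier M"
  shows "N \<subseteq> add_cyclic N u"
proof
  fix n assume n: "n \<in> N"
  then have "n = n \<oplus>\<^bsub>M\<^esub> \<zero> \<bullet> u" using submodD(1)[OF N] u by simp
  then show "n \<in> add_cyclic N u" using n unfolding add_cyclic_def by blast
qed

lemma mem_add_cyclic:
  assumes N: "submod N" and u: "u \<in> carrier M"
  shows "u \<in> add_cyclic N u"
proof -
  have "u = \<zero>\<^bsub>M\<^esub> \<oplus>\<^bsub>M\<^esub> \<one> \<bullet> u" using u by simp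
  then show ?thesis using submodD(2)[OF N] unfolding add_cyclic_def by blast
qed

lemma add_cyclic_mono: "N \<subseteq> N' \<Longrightarrow> add_cyclic N u \<subseteq> add_cyclic N' u"
  unfolding add_cyclic_def by blast

lemma add_cyclic_least:
  assumes "submod N'" "N \<subseteq> N'" "u \<in> N'"
  shows "add_cyclic N u \<subseteq> N'"
  using assms submodD(3,4)[OF assms(1)] unfolding add_cyclic_def by blast

section \<open>Chains of submodules\<close>

text \<open>The base case allows a proper inclusion, so that the upper end can be enlarged and two
  chains can be joined without counting the junction as a step.\<close>

inductive chain :: "'c set \<Rightarrow> nat \<Rightarrow> 'c set \<Rightarrow> bool" where
  chain_0: "\<lbrakk>submod N; submod N'; N \<subseteq> N'\<rbrakk> \<Longrightarrow> chain N 0 N'"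
| chain_Suc: "\<lbrakk>chain N p N'; submod N''; N' \<subseteq> N''; h \<in> N''; h \<notin> closure N'\<rbrakk> \<Longrightarrow> chain N (Suc p) N''"

lemma chain_submod: "chain N p N' \<Longrightarrow> submod N \<and> submod N' \<and> N \<subseteq> N'"
  by (induction rule: chain.induct) auto

lemma chain_weaken: "\<lbrakk>chain N p N'; N' \<subseteq> N''; submod N''\<rbrakk> \<Longrightarrow> chain N p N''"
proof (induction arbitrary: N'' rule: chain.induct)
  case (chain_0 N N')
  then show ?case by (auto intro: chain.chain_0)
next
  case (chain_Suc N p N' N1 h)
  then show ?case by (intro chain.chain_Suc[of N p N']) auto
qed

lemma chain_trans: "\<lbrakk>chain N' q N''; chain N p N'\<rbrakk> \<Longrightarrow> chain N (p + q) N''"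
proof (induction arbitrary: N p rule: chain.induct)
  case (chain_0 N' N'')
  then show ?case using chain_weaken by simp
next
  case (chain_Suc N' q N1 N2 h)
  then show ?case by (auto intro: chain.chain_Suc)
qed

lemma chain_add_cyclic:
  assumes "chain N p N'" "uniform u" "u \<notin> closure N'"
  shows "chain (add_cyclic N u) p (add_cyclic N' u)"
  using assms
proof (induction rule: chain.induct)
  case (chain_0 N N')
  then show ?case
    by (intro chain.chain_0 add_cyclic_submod add_cyclic_mono) (auto simp: uniform_def)
next
  case (chain_Suc N p N' N'' h)
  have u: "u \<in> carrier M" using chain_Suc.prems by (simp add: uniform_def)
  have N': "submod N'" using chain_submod[OF chain_Suc.hyps(1)] by simp
  have hM: "h \<in> carrier M" using chain_Suc.hyps submodD(1) by blast
  \<comment> \<open>If \<open>r \<bullet> h\<close> is the sum of \<open>n\<close> and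
    \<open>s \<bullet> u\<close>, then \<open>s \<bullet> u\<close> is a difference of members of
    \<open>N''\<close>. It vanishes because \<open>u\<close> is uniform and outside the closure of
    \<open>N''\<close>, so adding \<open>u\<close> puts no new multiples of \<open>h\<close> into
    the submodule.\<close>
  have "{r \<in> carrier R. r \<bullet> h \<in> add_cyclic N' u} \<subseteq> {r \<in> carrier R. r \<bullet> h \<in> N'}"
  proof clarify
    fix r assume r: "r \<in> carrier R" "r \<bullet> h \<in> add_cyclic N' u"
    then obtain n s where ns: "n \<in> N'" "s \<in> carrier R" "r \<bullet> h = n \<oplus>\<^bsub>M\<^esub> s \<bullet> u"
      unfolding add_cyclic_def by blast
    have "r \<bullet> h \<in> N''" "n \<in> N''"
      using r(1) ns(1) chain_Suc.hyps submodD(4) by auto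
    then have "s \<bullet> u \<in> N''"
      using submod_add_cancel[OF chain_Suc.hyps(2), of n "s \<bullet> u"] ns u by auto
    then have "s \<bullet> u = \<zero>\<^bsub>M\<^esub>"
      using uniform_in_closure[OF chain_Suc.hyps(2)] chain_Suc.prems ns(2) by blast
    then show "r \<bullet> h \<in> N'"
      using ns submodD(1)[OF N'] by simp
  qed
  then have "h \<notin> closure (add_cyclic N' u)"
    using chain_Suc.hyps(5) hM left_essential_mono by (auto simp: closure_def)
  moreover have "chain (add_cyclic N u) p (add_cyclic N' u)"
    using chain_Suc.IH chain_Suc.prems closure_mono[OF chain_Suc.hyps(3)] by blast
  moreover have "h \<in> add_cyclic N'' u"
    using subset_add_cyclic[OF chain_Suc.hyps(2) u] chain_Suc.hyps(4) by blast
  ultimately show ?case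
    using chain_Suc.hyps u
    by (intro chain.chain_Suc[of _ p "add_cyclic N' u" _ h] add_cyclic_submod add_cyclic_mono) auto
qed

end

locale nonsingular_left_module = left_module +
  assumes ring_nonsingular: left_nonsingular
    and nonsingular: "\<And>w. \<lbrakk>w \<in> carrier M; left_essential {r \<in> carrier R. r \<bullet> w = \<zero>\<^bsub>M\<^esub>}\<rbrakk> \<Longrightarrow> w = \<zero>\<^bsub>M\<^esub>"
begin

text \<open>One multiplication takes \<open>w\<close> into \<open>closure N\<close> and leaves
  \<open>c \<otimes> b\<close> nonzero. The essential left ideal needed to go on into
  \<open>N\<close> cannot annihilate \<open>c \<otimes> b\<close>, by nonsingularity of
  \<open>R\<close>.\<close>

lemma closure_idem:
  assumes N: "submod N"
  shows "closure (closure N) = closure N"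
proof
  show "closure N \<subseteq> closure (closure N)"
    by (rule closure_subset[OF closure_submod[OF N]])
  show "closure (closure N) \<subseteq> closure N"
  proof
    fix w assume "w \<in> closure (closure N)"
    then have w: "w \<in> carrier M" "left_essential {r \<in> carrier R. r \<bullet> w \<in> closure N}"
      by (auto simp: closure_def)
    have "\<exists>c\<in>carrier R. c \<otimes> b \<in> {r \<in> carrier R. r \<bullet> w \<in> N} \<and> c \<otimes> b \<noteq> \<zero>"
      if b: "b \<in> carrier R" "b \<noteq> \<zero>" for b
    proof -
      obtain c where c: "c \<in> carrier R" "c \<otimes> b \<noteq> \<zero>" "(c \<otimes> b) \<bullet> w \<in> closure N"
        using w(2) b unfolding left_essential_def by blast
      then have e: "left_essential {r \<in> carrier R. r \<bullet> (c \<otimes> b) \<bullet> w \<in> N}"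
        by (auto simp: closure_def)
      have "\<not> {r \<in> carrier R. r \<bullet> (c \<otimes> b) \<bullet> w \<in> N} \<subseteq> {r \<in> carrier R. r \<otimes> (c \<otimes> b) = \<zero>}"
        using left_essential_mono[OF e] ring_nonsingular c b
        unfolding left_nonsingular_def by (meson m_closed)
      then obtain d where "d \<in> carrier R" "d \<bullet> (c \<otimes> b) \<bullet> w \<in> N" "d \<otimes> (c \<otimes> b) \<noteq> \<zero>"
        by blast
      then show ?thesis
        using b c w(1) by (intro bexI[of _ "d \<otimes> c"]) (auto simp: m_assoc smult_assoc)
    qed
    then show "w \<in> closure N"
      using w(1) by (simp add: closure_def left_essential_def)
  qed
qed

text \<open>Steinitz exchange: the last step of the chain yields a uniform \<open>u \<in> U\<close> outside the closure
  of the preceding submodule; adding \<open>u\<close> to all members of the chain keeps the other steps strict.\<close>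

lemma chain_length_le:
  assumes "chain N p N'" "N' \<subseteq> V" "submod V" "finite U" "U \<subseteq> V" "\<And>u. u \<in> U \<Longrightarrow> uniform u"
    and "\<And>N'. \<lbrakk>submod N'; N \<subseteq> N'; U \<subseteq> N'\<rbrakk> \<Longrightarrow> V \<subseteq> closure N'"
  shows "p \<le> card U"
  using assms
proof (induction p arbitrary: N N' U)
  case (Suc p)
  from Suc.prems(1) obtain N1 h where N1: "chain N p N1" "N1 \<subseteq> N'" "h \<in> N'" "h \<notin> closure N1"
    by cases auto
  have sub: "submod N" "submod N1" "N \<subseteq> N1"
    using chain_submod[OF N1(1)] by auto
  \<comment> \<open>Otherwise density applies to \<open>closure N1\<close>, and idempotence puts all
    of \<open>V\<close>, with it \<open>h\<close>, into \<open>closure N1\<close>.\<close>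
  have "\<not> U \<subseteq> closure N1"
  proof
    assume "U \<subseteq> closure N1"
    then have "V \<subseteq> closure (closure N1)"
      using Suc.prems(7)[OF closure_submod[OF sub(2)]] closure_subset[OF sub(2)] sub(3) by auto
    then show False
      using closure_idem[OF sub(2)] N1 Suc.prems(2) by auto
  qed
  then obtain u where u: "u \<in> U" "u \<notin> closure N1" by blast
  have uM: "u \<in> carrier M" "uniform u" "u \<in> V"
    using u Suc.prems(5,6) by (auto simp: uniform_def)
  \<comment> \<open>Moving \<open>u\<close> from \<open>U\<close> into the base of the chain
    preserves density: every submodule above the new base contains \<open>u\<close>.\<close>
  have "p \<le> card (U - {u})"
  proof (rule Suc.IH)
    show "chain (add_cyclic N u) p (add_cyclic N1 u)"
      by (rule chain_add_cyclic[OF N1(1) uM(2) u(2)])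
    show "add_cyclic N1 u \<subseteq> V"
      using Suc.prems(2,3) N1(2) uM by (intro add_cyclic_least) auto
    show "V \<subseteq> closure K" if K: "submod K" "add_cyclic N u \<subseteq> K" "U - {u} \<subseteq> K" for K
      using K Suc.prems(7)[OF K(1)] subset_add_cyclic[OF sub(1) uM(1)]
        mem_add_cyclic[OF sub(1) uM(1)] by blast
  qed (use Suc.prems in auto)
  then show ?case
    using u(1) Suc.prems(4) by (metis Suc_le_eq card_Diff1_less le_less_trans)
qed simp

end

section \<open>Semiprime left Goldie rings\<close>

text \<open>If \<open>c\<close> is a nonzero element of \<open>I\<close> and of its
  \<open>k\<close>-th power, some \<open>c r c\<close> is nonzero. It is the product of
  \<open>c r\<close> in \<open>I\<close> with \<open>c\<close>, hence lies in the next power, so no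
  power of a nonzero ideal vanishes.\<close>

lemma semiprime_ringI:
  assumes "ring R"
    and sp: "\<And>a. \<lbrakk>a \<in> carrier R; \<forall>r\<in>carrier R. a \<otimes>\<^bsub>R\<^esub> r \<otimes>\<^bsub>R\<^esub> a = \<zero>\<^bsub>R\<^esub>\<rbrakk> \<Longrightarrow> a = \<zero>\<^bsub>R\<^esub>"
  shows "semiprime_ring R"
  unfolding semiprime_ring_def
proof (intro conjI allI impI)
  interpret ring R by fact
  fix I assume "nilpotent_ideal R I"
  then obtain n where I: "ideal I R" and n: "(ideal_prod R I ^^ n) (carrier R) = {\<zero>\<^bsub>R\<^esub>}"
    unfolding nilpotent_ideal_def by blast
  interpret I: ideal I R by fact
  show "I = {\<zero>\<^bsub>R\<^esub>}"
  proof (rule ccontr)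
    assume "I \<noteq> {\<zero>\<^bsub>R\<^esub>}"
    then obtain b where b: "b \<in> I" "b \<noteq> \<zero>\<^bsub>R\<^esub>" using I.zero_closed by blast
    have "\<exists>c. c \<in> I \<and> c \<in> (ideal_prod R I ^^ k) (carrier R) \<and> c \<noteq> \<zero>\<^bsub>R\<^esub>" for k
    proof (induction k)
      case 0
      then show ?case using b I.Icarr by auto
    next
      case (Suc k)
      then obtain c where c: "c \<in> I" "c \<in> (ideal_prod R I ^^ k) (carrier R)" "c \<noteq> \<zero>\<^bsub>R\<^esub>"
        by blast
      then obtain r where r: "r \<in> carrier R" "c \<otimes>\<^bsub>R\<^esub> r \<otimes>\<^bsub>R\<^esub> c \<noteq> \<zero>\<^bsub>R\<^esub>"
        using sp I.Icarr by blast
      moreover have "c \<otimes>\<^bsub>R\<^esub> r \<otimes>\<^bsub>R\<^esub> c \<in> ideal_prod R I ((ideal_prod R I ^^ k) (carrier R))"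
        using c r I.I_r_closed by (auto intro: ideal_prod.prod)
      ultimately show ?case
        using c I.I_l_closed I.I_r_closed I.Icarr by (auto intro!: exI[of _ "c \<otimes>\<^bsub>R\<^esub> r \<otimes>\<^bsub>R\<^esub> c"])
    qed
    then show False using n by (metis singletonD)
  qed
qed fact

text \<open>The ideal \<open>I\<close> generated by \<open>a\<close> has square zero. Two
  annihilators replace a description of its elements: \<open>P\<close> contains \<open>a\<close>,
  hence \<open>I\<close>, so \<open>a\<close> annihilates \<open>I\<close>; then \<open>Q\<close>
  contains \<open>a\<close>, hence \<open>I\<close>.\<close>

lemma semiprime_ringD:
  assumes sp: "semiprime_ring R" and a: "a \<in> carrier R"
    and ara: "\<And>r. r \<in> carrier R \<Longrightarrow> a \<otimes>\<^bsub>R\<^esub> r \<otimes>\<^bsub>R\<^esub> a = \<zero>\<^bsub>R\<^esub>"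
  shows "a = \<zero>\<^bsub>R\<^esub>"
proof -
  interpret ring R using sp by (simp add: semiprime_ring_def)
  define I where "I = Idl\<^bsub>R\<^esub> {a}"
  interpret I: ideal I R unfolding I_def using a by (intro genideal_ideal) auto
  have aI: "a \<in> I" unfolding I_def using a by (intro genideal_self') auto
  define P where "P = {y \<in> carrier R. \<forall>r\<in>carrier R. a \<otimes>\<^bsub>R\<^esub> r \<otimes>\<^bsub>R\<^esub> y = \<zero>\<^bsub>R\<^esub>}"
  have "ideal P R"
  proof (rule idealI)
    show "subgroup P (add_monoid R)"
      using a by (intro add.subgroupI) (auto simp: P_def r_distr r_minus intro!: exI[of _ "\<zero>\<^bsub>R\<^esub>"])
    show "x \<otimes>\<^bsub>R\<^esub> y \<in> P" if "y \<in> P" "x \<in> carrier R" for x y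
    proof -
      have "a \<otimes>\<^bsub>R\<^esub> r \<otimes>\<^bsub>R\<^esub> (x \<otimes>\<^bsub>R\<^esub> y) = a \<otimes>\<^bsub>R\<^esub> (r \<otimes>\<^bsub>R\<^esub> x) \<otimes>\<^bsub>R\<^esub> y" if "r \<in> carrier R" for r
        using that \<open>y \<in> P\<close> \<open>x \<in> carrier R\<close> a by (simp add: P_def m_assoc)
      then show ?thesis using that by (simp add: P_def)
    qed
    show "y \<otimes>\<^bsub>R\<^esub> x \<in> P" if "y \<in> P" "x \<in> carrier R" for x y
    proof -
      have "a \<otimes>\<^bsub>R\<^esub> r \<otimes>\<^bsub>R\<^esub> (y \<otimes>\<^bsub>R\<^esub> x) = a \<otimes>\<^bsub>R\<^esub> r \<otimes>\<^bsub>R\<^esub> y \<otimes>\<^bsub>R\<^esub> x" if "r \<in> carrier R" for r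
        using that \<open>y \<in> P\<close> \<open>x \<in> carrier R\<close> a by (simp add: P_def m_assoc)
      then show ?thesis using that by (simp add: P_def)
    qed
  qed (rule ring_axioms)
  then have "I \<subseteq> P"
    unfolding I_def using a ara by (intro genideal_minimal) (auto simp: P_def)
  define Q where "Q = {z \<in> carrier R. \<forall>y\<in>I. z \<otimes>\<^bsub>R\<^esub> y = \<zero>\<^bsub>R\<^esub>}"
  have "ideal Q R"
  proof (rule idealI)
    show "subgroup Q (add_monoid R)"
      using I.Icarr by (intro add.subgroupI) (auto simp: Q_def l_distr l_minus intro!: exI[of _ "\<zero>\<^bsub>R\<^esub>"])
    show "x \<otimes>\<^bsub>R\<^esub> y \<in> Q" if "y \<in> Q" "x \<in> carrier R" for x y
      using that I.Icarr unfolding Q_def by (auto simp: m_assoc)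
    show "y \<otimes>\<^bsub>R\<^esub> x \<in> Q" if "y \<in> Q" "x \<in> carrier R" for x y
      using that I.Icarr I.I_l_closed unfolding Q_def by (auto simp: m_assoc)
  qed (rule ring_axioms)
  moreover have "a \<in> Q"
  proof -
    have "a \<otimes>\<^bsub>R\<^esub> y = \<zero>\<^bsub>R\<^esub>" if "y \<in> I" for y
    proof -
      have "a \<otimes>\<^bsub>R\<^esub> \<one>\<^bsub>R\<^esub> \<otimes>\<^bsub>R\<^esub> y = \<zero>\<^bsub>R\<^esub>"
        using \<open>I \<subseteq> P\<close> that unfolding P_def by blast
      then show ?thesis using a by simp
    qed
    then show ?thesis using a by (simp add: Q_def)
  qed
  ultimately have IQ: "I \<subseteq> Q"
    unfolding I_def by (intro genideal_minimal) auto
  have "ideal_prod R I (ideal_prod R I (carrier R)) \<subseteq> {\<zero>\<^bsub>R\<^esub>}"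
  proof
    fix x assume "x \<in> ideal_prod R I (ideal_prod R I (carrier R))"
    then show "x \<in> {\<zero>\<^bsub>R\<^esub>}"
    proof induction
      case (prod i j)
      \<comment> \<open>Powers start from the whole ring, so \<open>j\<close> comes from the product
        of \<open>I\<close> with \<open>R\<close>.\<close>
      have "j \<in> I"
        using prod(2) by induction (simp_all add: I.I_r_closed)
      then show ?case using prod(1) IQ by (auto simp: Q_def)
    qed simp
  qed
  moreover have "\<zero>\<^bsub>R\<^esub> \<in> ideal_prod R I (ideal_prod R I (carrier R))"
    using ideal_prod.prod[of "\<zero>\<^bsub>R\<^esub>" I "\<zero>\<^bsub>R\<^esub>" "carrier R" R]
      ideal_prod.prod[of "\<zero>\<^bsub>R\<^esub>" I "\<zero>\<^bsub>R\<^esub>" "ideal_prod R I (carrier R)" R] I.zero_closed by simp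
  ultimately have "ideal_prod R I (ideal_prod R I (carrier R)) = {\<zero>\<^bsub>R\<^esub>}"
    by blast
  then have "(ideal_prod R I ^^ 2) (carrier R) = {\<zero>\<^bsub>R\<^esub>}"
    by (simp add: numeral_2_eq_2)
  then have "nilpotent_ideal R I"
    unfolding nilpotent_ideal_def using I.ideal_axioms by blast
  then show ?thesis
    using sp aI unfolding semiprime_ring_def by blast
qed

text \<open>A nonzero left ideal of a semiprime ring does not satisfy the identity \<open>x\<^sup>2 = 0\<close>:
  linearised at \<open>x\<close> and \<open>r x\<close>, that identity gives \<open>x r x = 0\<close>.\<close>

lemma semiprime_multiple_square_nonzero:
  assumes sp: "semiprime_ring R" and a: "a \<in> carrier R" "a \<noteq> \<zero>\<^bsub>R\<^esub>"
  shows "\<exists>r\<in>carrier R. (r \<otimes>\<^bsub>R\<^esub> a) \<otimes>\<^bsub>R\<^esub> (r \<otimes>\<^bsub>R\<^esub> a) \<noteq> \<zero>\<^bsub>R\<^esub>"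
proof (rule ccontr)
  interpret ring R using sp by (simp add: semiprime_ring_def)
  assume "\<not> ?thesis"
  then have sq: "(r \<otimes>\<^bsub>R\<^esub> a) \<otimes>\<^bsub>R\<^esub> (r \<otimes>\<^bsub>R\<^esub> a) = \<zero>\<^bsub>R\<^esub>" if "r \<in> carrier R" for r
    using that by blast
  have "a \<otimes>\<^bsub>R\<^esub> r \<otimes>\<^bsub>R\<^esub> a = \<zero>\<^bsub>R\<^esub>" if r: "r \<in> carrier R" for r
  proof -
    have aa: "a \<otimes>\<^bsub>R\<^esub> a = \<zero>\<^bsub>R\<^esub>"
      using sq[of "\<one>\<^bsub>R\<^esub>"] a by simp
    have "(\<one>\<^bsub>R\<^esub> \<oplus>\<^bsub>R\<^esub> r) \<otimes>\<^bsub>R\<^esub> a = a \<oplus>\<^bsub>R\<^esub> r \<otimes>\<^bsub>R\<^esub> a"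
      using a r by (simp add: l_distr)
    then have "(a \<oplus>\<^bsub>R\<^esub> r \<otimes>\<^bsub>R\<^esub> a) \<otimes>\<^bsub>R\<^esub> (a \<oplus>\<^bsub>R\<^esub> r \<otimes>\<^bsub>R\<^esub> a) = \<zero>\<^bsub>R\<^esub>"
      using sq[of "\<one>\<^bsub>R\<^esub> \<oplus>\<^bsub>R\<^esub> r"] r by simp
    moreover have "(a \<oplus>\<^bsub>R\<^esub> r \<otimes>\<^bsub>R\<^esub> a) \<otimes>\<^bsub>R\<^esub> (a \<oplus>\<^bsub>R\<^esub> r \<otimes>\<^bsub>R\<^esub> a)
        = (a \<otimes>\<^bsub>R\<^esub> a \<oplus>\<^bsub>R\<^esub> a \<otimes>\<^bsub>R\<^esub> (r \<otimes>\<^bsub>R\<^esub> a)) \<oplus>\<^bsub>R\<^esub> (r \<otimes>\<^bsub>R\<^esub> (a \<otimes>\<^bsub>R\<^esub> a) \<oplus>\<^bsub>R\<^esub> (r \<otimes>\<^bsub>R\<^esub> a) \<otimes>\<^bsub>R\<^esub> (r \<otimes>\<^bsub>R\<^esub> a))"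
      using a r by (simp add: l_distr r_distr m_assoc a_ac)
    ultimately show ?thesis
      using aa sq[OF r] a r by (simp add: m_assoc)
  qed
  then show False
    using semiprime_ringD[OF sp a(1)] a(2) by blast
qed

section \<open>Finite uniform dimension and nonsingularity of the base ring\<close>

sublocale ring \<subseteq> regular: left_module R R "(\<otimes>)"
  by unfold_locales (simp_all add: l_distr r_distr m_assoc)

context ring
begin

text \<open>The left ideal generated by \<open>c k\<close> meets \<open>N k\<close> in zero, while
  all earlier ones lie in \<open>N k\<close>, so their sum is direct. The \<open>N k\<close> may
  form an ascending chain, as in \<open>wf_closed_left_ideals\<close>, or be annihilators of varying
  elements, as in \<open>semiprime_Ore\<close>.\<close>

lemma no_independent_sequence:
  assumes fin: "finite_left_uniform_dim R"
    and c: "\<And>k::nat. c k \<in> carrier R" "\<And>k. c k \<noteq> \<zero>"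
    and N: "\<And>k. regular.submod (N k)" "\<And>i k. i < k \<Longrightarrow> c i \<in> N k"
    and cN: "\<And>k r. \<lbrakk>r \<in> carrier R; r \<otimes> c k \<in> N k\<rbrakk> \<Longrightarrow> r \<otimes> c k = \<zero>"
  shows False
proof -
  define P where "P k = {r \<otimes> c k | r. r \<in> carrier R}" for k
  have cP: "c k \<in> P k" for k
  proof -
    have "c k = \<one> \<otimes> c k" using c by simp
    then show ?thesis unfolding P_def by blast
  qed
  have PR: "P k \<subseteq> carrier R" for k
    using c by (auto simp: P_def)
  have PN: "P i \<subseteq> N k" if "i < k" for i k
    using regular.submodD(4)[OF N(1)] N(2)[OF that] unfolding P_def by blast
  have left_ideal: "left_ideal (P k) R" for k
  proof (intro left_ideal.intro additive_subgroup.intro left_ideal_axioms.intro)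
    show "subgroup (P k) (add_monoid R)"
    proof (rule add.subgroupI)
      show "\<ominus> a \<in> P k" if "a \<in> P k" for a
      proof -
        obtain r where r: "r \<in> carrier R" "a = r \<otimes> c k" using \<open>a \<in> P k\<close> by (auto simp: P_def)
        then have "\<ominus> a = (\<ominus> r) \<otimes> c k" using c(1)[of k] by (simp add: l_minus)
        then show ?thesis using r(1) unfolding P_def by blast
      qed
      show "a \<oplus> b \<in> P k" if "a \<in> P k" "b \<in> P k" for a b
      proof -
        obtain r s where r: "r \<in> carrier R" "a = r \<otimes> c k" "s \<in> carrier R" "b = s \<otimes> c k"
          using \<open>a \<in> P k\<close> \<open>b \<in> P k\<close> by (auto simp: P_def)
        then have "a \<oplus> b = (r \<oplus> s) \<otimes> c k" using c(1)[of k] by (simp add: l_distr)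
        then show ?thesis using r(1,3) unfolding P_def by blast
      qed
    qed (use cP[of k] PR[of k] in auto)
    show "x \<otimes> a \<in> P k" if "a \<in> P k" "x \<in> carrier R" for a x
    proof -
      obtain r where r: "r \<in> carrier R" "a = r \<otimes> c k" using \<open>a \<in> P k\<close> by (auto simp: P_def)
      then have "x \<otimes> a = (x \<otimes> r) \<otimes> c k" using c(1)[of k] that by (simp add: m_assoc)
      then show ?thesis using r(1) that unfolding P_def by blast
    qed
  qed (rule ring_axioms)
  \<comment> \<open>Direct sums are given by sets of left ideals, so infinitely many indices must
    yield infinitely many sets.\<close>
  have "inj P"
  proof (rule linorder_injI)
    fix i k :: nat assume "i < k"
    show "P i \<noteq> P k"
    proof
      assume "P i = P k"
      then have "\<one> \<otimes> c k \<in> N k" using cP[of k] PN[OF \<open>i < k\<close>] c(1)[of k] by (simp add: subset_iff)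
      then show False using cN[of \<one> k] c[of k] by simp
    qed
  qed
  have indep: "\<forall>k\<in>G. y k = \<zero>"
    if "finite G" "\<forall>k\<in>G. y k \<in> P k" "(\<Oplus>k\<in>G. y k) = \<zero>" for G and y :: "nat \<Rightarrow> 'a"
    using that
  \<comment> \<open>Split off the largest index \<open>k\<close>: the other summands lie in
    \<open>N k\<close>, hence so does \<open>y k\<close>, which therefore vanishes.\<close>
  proof (induction G rule: finite_linorder_max_induct)
    case (insert k G)
    have yR: "y i \<in> carrier R" if "i \<in> insert k G" for i
      using insert.prems PR that by auto
    have "k \<notin> G" using insert.hyps by auto
    then have sum: "y k \<oplus> (\<Oplus>i\<in>G. y i) = \<zero>"
      using insert.prems(2) finsum_insert[OF insert.hyps(1) \<open>k \<notin> G\<close>, of y] yR by (simp add: Pi_iff)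
    have sN: "(\<Oplus>i\<in>G. y i) \<in> N k"
      using insert.prems(1) insert.hyps(2) PN by (intro regular.submod_finsum N) blast
    have "y k \<in> N k"
    proof (rule regular.submod_add_cancel[OF N(1) sN])
      show "(\<Oplus>i\<in>G. y i) \<oplus> y k \<in> N k"
        using sum yR regular.submodD(1)[OF N(1) sN] regular.submodD(2)[OF N(1)] by (simp add: a_comm)
    qed (simp add: yR)
    moreover obtain r where "r \<in> carrier R" "y k = r \<otimes> c k"
      using insert.prems(1) by (auto simp: P_def)
    ultimately have "y k = \<zero>"
      using cN by simp
    then have "(\<Oplus>i\<in>G. y i) = \<zero>"
      using sum regular.submodD(1)[OF N(1) sN] by simp
    then show ?case
      using insert.IH insert.prems(1) \<open>y k = \<zero>\<close> by blast
  qed simp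
  have "direct_left_ideals R (range P)"
    unfolding direct_left_ideals_def
  proof (intro conjI allI impI)
    show "\<forall>J\<in>range P. left_ideal J R" using left_ideal by auto
    fix F y assume F: "finite F" "F \<subseteq> range P" and y: "y \<in> (\<Pi> J\<in>F. J)" "(\<Oplus>J\<in>F. y J) = \<zero>"
    then obtain G where G: "finite G" "F = P ` G"
      using finite_subset_image[OF F] by blast
    have yP: "\<forall>k\<in>G. y (P k) \<in> P k"
      using y G by auto
    have "(\<Oplus>J\<in>P ` G. y J) = (\<Oplus>k\<in>G. y (P k))"
    proof (rule finsum_reindex)
      show "inj_on P G" using \<open>inj P\<close> by (rule inj_on_subset) simp
    qed (use yP PR in auto)
    then show "\<forall>J\<in>F. y J = \<zero>"
      using indep[OF G(1) yP] y(2) G(2) by simp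
  qed
  moreover have "infinite (range P)"
    using \<open>inj P\<close> by (simp add: finite_image_iff)
  moreover have "\<forall>J\<in>range P. J \<noteq> {\<zero>}"
    using cP c(2) by blast
  ultimately show False
    using fin unfolding finite_left_uniform_dim_def by blast
qed

text \<open>Choose a nonzero \<open>a\<close> in the singular ideal \<open>Z\<close> with maximal
  left annihilator. For \<open>z\<close> in \<open>Z\<close>, the essential annihilator of
  \<open>z\<close> contains a nonzero \<open>c a\<close>. If \<open>a z\<close> were nonzero, its
  annihilator would contain that of \<open>a\<close> and also \<open>c\<close>, against maximality.
  Hence \<open>a\<close> annihilates \<open>Z\<close>, so \<open>a R a = 0\<close>.\<close>

lemma semiprime_acc_left_nonsingular:
  assumes sp: "semiprime_ring R" and acc: "acc_left_annihilators R"
  shows left_nonsingular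
proof (rule ccontr)
  define Z where "Z = regular.closure {\<zero>}"
  have Z: "regular.submod Z"
    unfolding Z_def by (intro regular.closure_submod regular.submod_zero)
  have Z_r: "z \<otimes> r \<in> Z" if z: "z \<in> Z" and r: "r \<in> carrier R" for z r
  proof -
    have "{s \<in> carrier R. s \<otimes> z = \<zero>} \<subseteq> {s \<in> carrier R. s \<otimes> (z \<otimes> r) = \<zero>}"
      using z r by (auto simp: Z_def regular.closure_def m_assoc[symmetric])
    then show ?thesis
      using z r left_essential_mono by (auto simp: Z_def regular.closure_def)
  qed
  define ann where "ann a = left_annihilator R {a}" for a
  define W where "W = {(A, B). A \<in> ann ` carrier R \<and> B \<in> ann ` carrier R \<and> B \<subset> A}"
  have "wf W"
    unfolding wf_iff_no_infinite_down_chain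
  proof
    assume "\<exists>f. \<forall>i. (f (Suc i), f i) \<in> W"
    then obtain f where "\<forall>i. (f (Suc i), f i) \<in> W" by blast
    then have f: "f (Suc i) \<in> ann ` carrier R" "f i \<in> ann ` carrier R" "f i \<subset> f (Suc i)" for i
      by (simp_all add: W_def)
    have "\<exists>S \<subseteq> carrier R. f n = left_annihilator R S" for n
      using f(2)[of n] unfolding ann_def by auto
    then obtain K where "\<forall>n\<ge>K. f n = f K"
      using acc f(3) unfolding acc_left_annihilators_def by (metis psubset_imp_subset)
    then show False
      using f(3)[of K] by (metis le_Suc_eq order_refl psubset_eq)
  qed
  assume "\<not> left_nonsingular"
  then obtain a0 where "a0 \<in> Z - {\<zero>}"
    by (auto simp: left_nonsingular_def Z_def regular.closure_def)
  then obtain A where A: "A \<in> ann ` (Z - {\<zero>})" and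
    Amin: "\<And>B. (B, A) \<in> W \<Longrightarrow> B \<notin> ann ` (Z - {\<zero>})"
    using wfE_min[OF \<open>wf W\<close>, of "ann a0" "ann ` (Z - {\<zero>})"] by blast
  then obtain a where a: "a \<in> Z" "a \<noteq> \<zero>" "A = ann a" by blast
  have aR: "a \<in> carrier R" using a regular.submodD(1)[OF Z] by blast
  have az: "a \<otimes> z = \<zero>" if z: "z \<in> Z" for z
  proof (rule ccontr)
    assume nz: "a \<otimes> z \<noteq> \<zero>"
    have zR: "z \<in> carrier R" using z regular.submodD(1)[OF Z] by blast
    obtain c where c: "c \<in> carrier R" "c \<otimes> a \<otimes> z = \<zero>" "c \<otimes> a \<noteq> \<zero>"
      using z a(2) aR unfolding Z_def regular.closure_def left_essential_def by blast
    have "ann a \<subseteq> ann (a \<otimes> z)"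
      using aR zR by (auto simp: ann_def left_annihilator_def m_assoc[symmetric])
    moreover have "c \<in> ann (a \<otimes> z)" "c \<notin> ann a"
      using c aR zR by (simp_all add: ann_def left_annihilator_def m_assoc)
    ultimately have "ann a \<subset> ann (a \<otimes> z)"
      by blast
    then have "(ann (a \<otimes> z), A) \<in> W"
      using a aR zR by (auto simp: W_def)
    then show False
      using Amin Z_r[OF a(1) zR] nz by blast
  qed
  have "a \<otimes> r \<otimes> a = \<zero>" if "r \<in> carrier R" for r
    using az[OF regular.submodD(4)[OF Z that a(1)]] aR that by (simp add: m_assoc)
  then show False
    using semiprime_ringD[OF sp aR] a(2) by blast
qed

text \<open>Every strict step out of a closed left ideal leaves room for a nonzero cyclic left ideal
  independent of it, so an infinite ascending chain would give an infinite direct sum.\<close>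

lemma wf_closed_left_ideals:
  assumes fin: "finite_left_uniform_dim R"
  shows "wf {(N', N). regular.submod N' \<and> regular.submod N \<and> regular.closure N = N \<and> N \<subset> N'}"
  unfolding wf_iff_no_infinite_down_chain
proof
  assume "\<exists>f. \<forall>i. (f (Suc i), f i) \<in>
    {(N', N). regular.submod N' \<and> regular.submod N \<and> regular.closure N = N \<and> N \<subset> N'}"
  then obtain f where "\<forall>i. (f (Suc i), f i) \<in>
    {(N', N). regular.submod N' \<and> regular.submod N \<and> regular.closure N = N \<and> N \<subset> N'}" by blast
  then have f: "regular.submod (f i)" "regular.closure (f i) = f i" "f i \<subset> f (Suc i)" for i
    by simp_all
  have "\<exists>c. c \<in> f (Suc i) \<and> c \<noteq> \<zero> \<and> (\<forall>r\<in>carrier R. r \<otimes> c \<in> f i \<longrightarrow> r \<otimes> c = \<zero>)" for i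
  proof -
    obtain w where w: "w \<in> f (Suc i)" "w \<notin> f i" using f(3) by blast
    moreover have "w \<in> carrier R" using w f(1) regular.submodD(1) by blast
    ultimately obtain b where "b \<in> carrier R" "b \<otimes> w \<noteq> \<zero>"
      "\<And>r. \<lbrakk>r \<in> carrier R; r \<otimes> (b \<otimes> w) \<in> f i\<rbrakk> \<Longrightarrow> r \<otimes> (b \<otimes> w) = \<zero>"
      using regular.not_in_closureE[OF f(1)[of i]] f(2) by metis
    then show ?thesis
      using regular.submodD(4)[OF f(1)] w(1) by blast
  qed
  then obtain c where c: "c i \<in> f (Suc i)" "c i \<noteq> \<zero>"
    "\<And>r. \<lbrakk>r \<in> carrier R; r \<otimes> c i \<in> f i\<rbrakk> \<Longrightarrow> r \<otimes> c i = \<zero>" for i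
    by metis
  have mono: "f i \<subseteq> f k" if "i \<le> k" for i k
    using lift_Suc_mono_le[of f] f(3) that by blast
  show False
  proof (rule no_independent_sequence[OF fin, of c f])
    show "c i \<in> f k" if "i < k" for i k
      using c(1)[of i] mono[of "Suc i" k] that by auto
    show "c k \<in> carrier R" for k
      using c(1) f(1) regular.submodD(1) by blast
  qed (use c f in auto)
qed

text \<open>Let \<open>N\<close> be maximal among the proper closed left ideals above
  \<open>N0\<close>. A nonzero cyclic left ideal independent of \<open>N\<close> is uniform, because
  \<open>N\<close> together with any nonzero part of it has closure \<open>R\<close>.\<close>

lemma ex_uniform_notin_closure:
  assumes ns: left_nonsingular and fin: "finite_left_uniform_dim R"
    and N0: "regular.submod N0" "regular.closure N0 \<noteq> carrier R"
  shows "\<exists>b. regular.uniform b \<and> b \<notin> regular.closure N0"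
proof -
  interpret regular: nonsingular_left_module R R "(\<otimes>)"
    using ns by unfold_locales (auto simp: left_nonsingular_def)
  define Q where "Q = {N. regular.submod N \<and> regular.closure N = N \<and> N0 \<subseteq> N \<and> N \<noteq> carrier R}"
  have "regular.closure N0 \<in> Q"
    using N0 regular.closure_submod regular.closure_idem regular.closure_subset by (simp add: Q_def)
  then obtain N where N: "N \<in> Q" and Nmax: "\<And>K. \<lbrakk>regular.submod K; N \<subset> K\<rbrakk> \<Longrightarrow> K \<notin> Q"
    using wfE_min[OF wf_closed_left_ideals[OF fin], of "regular.closure N0" Q]
    unfolding Q_def by (smt (verit) case_prodI mem_Collect_eq)
  have sub: "regular.submod N" "regular.closure N = N" "N0 \<subseteq> N" "N \<noteq> carrier R"
    using N by (auto simp: Q_def)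
  have "\<one> \<notin> N"
    using sub regular.submodD(1,4)[OF sub(1)] by (metis r_one subsetI subset_antisym)
  then obtain b where b: "b \<in> carrier R" "b \<noteq> \<zero>" "\<And>r. \<lbrakk>r \<in> carrier R; r \<otimes> b \<in> N\<rbrakk> \<Longrightarrow> r \<otimes> b = \<zero>"
    using regular.not_in_closureE[OF sub(1), of \<one>] sub(2) by (metis one_closed r_one)
  have "\<exists>t\<in>carrier R. \<exists>q\<in>carrier R. t \<otimes> (r \<otimes> b) = q \<otimes> (s \<otimes> b) \<and> t \<otimes> (r \<otimes> b) \<noteq> \<zero>"
    if r: "r \<in> carrier R" "r \<otimes> b \<noteq> \<zero>" and s: "s \<in> carrier R" "s \<otimes> b \<noteq> \<zero>" for r s
  proof -
    let ?M = "regular.add_cyclic N (s \<otimes> b)"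
    have M: "regular.submod ?M" "N \<subseteq> ?M" "s \<otimes> b \<in> ?M"
      using regular.add_cyclic_submod regular.subset_add_cyclic regular.mem_add_cyclic sub(1) s(1) b(1)
      by simp_all
    have "N \<subset> regular.closure ?M"
      using M regular.closure_subset[OF M(1)] b(3)[OF s(1)] s(2) by blast
    then have "regular.closure ?M \<notin> Q"
      using Nmax regular.closure_submod M(1) by blast
    then have "regular.closure ?M = carrier R"
      using \<open>N \<subset> regular.closure ?M\<close> regular.closure_submod[OF M(1)] regular.closure_idem[OF M(1)] sub
      by (auto simp: Q_def)
    then have "left_essential {t \<in> carrier R. t \<otimes> (r \<otimes> b) \<in> ?M}"
      using r b(1) unfolding regular.closure_def by blast
    then have "\<not> {t \<in> carrier R. t \<otimes> (r \<otimes> b) \<in> ?M} \<subseteq> {t \<in> carrier R. t \<otimes> (r \<otimes> b) = \<zero>}"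
      using left_essential_mono ns r b(1) unfolding left_nonsingular_def by (meson m_closed)
    then obtain t where t: "t \<in> carrier R" "t \<otimes> (r \<otimes> b) \<in> ?M" "t \<otimes> (r \<otimes> b) \<noteq> \<zero>"
      by blast
    then obtain n q where nq: "n \<in> N" "q \<in> carrier R" "t \<otimes> (r \<otimes> b) = n \<oplus> q \<otimes> (s \<otimes> b)"
      unfolding regular.add_cyclic_def by blast
    have nR: "n \<in> carrier R" using nq(1) regular.submodD(1)[OF sub(1)] by blast
    \<comment> \<open>This exhibits \<open>n\<close> as a left multiple of \<open>b\<close>; it also
      lies in \<open>N\<close>, and the two left ideals meet only in zero.\<close>
    have "(t \<otimes> r \<ominus> q \<otimes> s) \<otimes> b = t \<otimes> (r \<otimes> b) \<ominus> q \<otimes> (s \<otimes> b)"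
      using t(1) nq(2) r(1) s(1) b(1) by (simp add: minus_eq l_distr l_minus m_assoc)
    also have "\<dots> = n"
      using nq nR s(1) b(1) by (simp add: minus_eq a_assoc r_neg)
    finally have "n = \<zero>"
      using b(3)[of "t \<otimes> r \<ominus> q \<otimes> s"] t(1) nq(1,2) r(1) s(1) by simp
    then show ?thesis
      using nq t s(1) b(1) by auto
  qed
  then have "regular.uniform b"
    using b(1) unfolding regular.uniform_def by blast
  moreover have "b \<notin> N"
    using b(1,2) b(3)[of \<one>] by auto
  ultimately show ?thesis
    using regular.closure_mono[OF sub(3)] sub(2) by auto
qed

text \<open>Uniform elements are added one at a time outside the current closed left ideal until the
  chain condition stops the process. The cardinality of \<open>U\<close> serves as the
  \<open>n\<close> of the later count.\<close>

lemma ex_dense_uniform_set: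
  assumes ns: left_nonsingular and fin: "finite_left_uniform_dim R"
  shows "\<exists>U. finite U \<and> (\<forall>u\<in>U. regular.uniform u) \<and>
    (\<forall>N. regular.submod N \<longrightarrow> U \<subseteq> N \<longrightarrow> regular.closure N = carrier R)"
proof -
  interpret regular: nonsingular_left_module R R "(\<otimes>)"
    using ns by unfold_locales (auto simp: left_nonsingular_def)
  have "\<exists>U. finite U \<and> (\<forall>u\<in>U. regular.uniform u) \<and>
      (\<forall>K. regular.submod K \<longrightarrow> N \<union> U \<subseteq> K \<longrightarrow> regular.closure K = carrier R)"
    if "regular.submod N" "regular.closure N = N" for N
    using wf_closed_left_ideals[OF fin] that
  proof (induction N rule: wf_induct_rule)
    case (less N)
    show ?case
    proof (cases "N = carrier R")
      case True
      have "regular.closure K = carrier R" if "regular.submod K" "N \<union> {} \<subseteq> K" for K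
        using regular.closure_subset[OF that(1)] that(2) True by (auto simp: regular.closure_def)
      then show ?thesis
        by (intro exI[of _ "{}"]) simp
    next
      case False
      then obtain b where b: "regular.uniform b" "b \<notin> N"
        using ex_uniform_notin_closure[OF ns fin less.prems(1)] less.prems(2) by auto
      have bR: "b \<in> carrier R" using b(1) by (simp add: regular.uniform_def)
      let ?M = "regular.add_cyclic N b"
      have M: "regular.submod ?M" "N \<subseteq> ?M" "b \<in> ?M"
        using regular.add_cyclic_submod regular.subset_add_cyclic regular.mem_add_cyclic less.prems(1) bR
        by simp_all
      have "N \<subset> regular.closure ?M"
        using M b(2) regular.closure_subset[OF M(1)] by blast
      then have "(regular.closure ?M, N) \<in>
          {(N', N). regular.submod N' \<and> regular.submod N \<and> regular.closure N = N \<and> N \<subset> N'}"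
        using less.prems regular.closure_submod[OF M(1)] by simp
      from less.IH[OF this regular.closure_submod[OF M(1)] regular.closure_idem[OF M(1)]]
      obtain U where U: "finite U" "\<forall>u\<in>U. regular.uniform u"
        and dense: "\<And>K. \<lbrakk>regular.submod K; regular.closure ?M \<union> U \<subseteq> K\<rbrakk> \<Longrightarrow> regular.closure K = carrier R"
        by blast
      have "regular.closure K = carrier R" if K: "regular.submod K" "N \<union> insert b U \<subseteq> K" for K
      proof -
        have "?M \<subseteq> K"
          using K by (intro regular.add_cyclic_least) auto
        then have "regular.closure (regular.closure K) = carrier R"
          using K regular.closure_mono[of ?M K] regular.closure_subset[OF K(1)]
          by (intro dense regular.closure_submod) auto
        then show ?thesis
          using regular.closure_idem[OF K(1)] by simp
      qed
      then show ?thesis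
        using U b(1) by (intro exI[of _ "insert b U"]) auto
    qed
  qed
  from this[of "regular.closure {\<zero>}"] obtain U where U: "finite U" "\<forall>u\<in>U. regular.uniform u"
    and dense: "\<And>K. \<lbrakk>regular.submod K; regular.closure {\<zero>} \<union> U \<subseteq> K\<rbrakk> \<Longrightarrow> regular.closure K = carrier R"
    using regular.closure_submod[OF regular.submod_zero] regular.closure_idem[OF regular.submod_zero]
    by blast
  have "regular.closure K = carrier R" if K: "regular.submod K" "U \<subseteq> K" for K
  proof -
    have "{\<zero>} \<subseteq> K" using regular.submodD(2)[OF K(1)] by simp
    then have "regular.closure (regular.closure K) = carrier R"
      using K regular.closure_mono regular.closure_subset[OF K(1)]
      by (intro dense regular.closure_submod) auto
    then show ?thesis
      using regular.closure_idem[OF K(1)] by simp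
  qed
  then show ?thesis using U by blast
qed

end

section \<open>Polynomials of bounded degree\<close>

lemma (in ore) left_module_Ore: "left_module R Ore (\<lambda>a f n. a \<otimes> f n)"
proof (intro left_module.intro left_module_axioms.intro)
  show "abelian_group Ore"
    using ring_Ore by (rule ring.is_abelian_group)
qed (auto simp: carrier_Ore up_smult_closed add_Ore l_distr r_distr m_assoc mem_upD intro!: ring_axioms)

sublocale ore \<subseteq> poly: left_module R "ore_extension R \<sigma> \<delta>" "\<lambda>a f n. a \<otimes> f n"
  by (rule left_module_Ore)

context ore
begin

abbreviation scaled_pow :: "'a \<Rightarrow> nat \<Rightarrow> nat \<Rightarrow> 'a" where
  "scaled_pow a k \<equiv> (\<lambda>i. if i = k then a else \<zero>)"

definition polys :: "nat \<Rightarrow> (nat \<Rightarrow> 'a) set" where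
  "polys m = {f \<in> up R. \<forall>n>m. f n = \<zero>}"

lemma polys_submod: "poly.submod (polys m)"
  unfolding poly.submod_def polys_def
  by (auto simp: carrier_Ore zero_Ore add_Ore up_zero up_add_closed up_smult_closed)

lemma submod_Int_polys: "poly.submod N \<Longrightarrow> poly.submod (N \<inter> polys m)"
  using polys_submod[of m] unfolding poly.submod_def by blast

lemma scaled_pow_mult:
  assumes "f \<in> up R"
  shows "r \<in> carrier R \<Longrightarrow> scaled_pow r 0 \<otimes>\<^bsub>Ore\<^esub> f = (\<lambda>n. r \<otimes> f n)"
    and "scaled_pow \<one> l \<otimes>\<^bsub>Ore\<^esub> f = (shift ^^ l) f"
  using assms by (simp_all add: mult_monom mem_upD)

text \<open>The \<open>\<delta>\<close>-part of a shift does not raise the degree, so only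
  \<open>\<sigma>\<close> acts on the top coefficient. The bound \<open>d\<close> is formal:
  \<open>f d\<close> may be zero.\<close>

lemma shift_pow_degree:
  assumes f: "f \<in> up R" and d: "\<forall>n>d. f n = \<zero>"
  shows "(\<forall>n>d + l. (shift ^^ l) f n = \<zero>) \<and> (shift ^^ l) f (d + l) = (\<sigma> ^^ l) (f d)"
proof (induction l)
  case (Suc l)
  have "(shift ^^ l) f n \<in> carrier R" for n
    using f by (auto intro: mem_upD)
  moreover have "(\<sigma> ^^ l) (f d) \<in> carrier R"
    using mem_upD[OF f] by (induction l) auto
  ultimately show ?case
    using Suc by (auto simp: ore_shift_def split: nat.split)
qed (use d in simp)

lemma nonzero_degree:
  assumes f: "f \<in> up R" "f \<noteq> (\<lambda>_. \<zero>)"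
  obtains d where "f d \<noteq> \<zero>" "\<forall>n>d. f n = \<zero>"
proof -
  obtain N where N: "bound \<zero> N f" using f(1) by blast
  obtain k where "f k \<noteq> \<zero>" using f(2) by auto
  moreover have "\<forall>n. f n \<noteq> \<zero> \<longrightarrow> n \<le> N"
    using bound.bound[OF N] by (auto simp: not_le[symmetric])
  ultimately show thesis
    using Greatest_le_nat[of "\<lambda>n. f n \<noteq> \<zero>" _ N] GreatestI_nat[of "\<lambda>n. f n \<noteq> \<zero>" k N]
      that[of "GREATEST n. f n \<noteq> \<zero>"] by (meson leD)
qed

text \<open>Formal degree bounds are used because the top coefficient may vanish;
  \<open>semiprime_Ore\<close> draws its equations from exactly that case.\<close>

lemma mult_top_coeff:
  assumes f: "f \<in> up R" "\<forall>n>d. f n = \<zero>" and g: "g \<in> up R" "\<forall>n>e. g n = \<zero>"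
  shows "(f \<otimes>\<^bsub>Ore\<^esub> g) (d + e) = f d \<otimes> (\<sigma> ^^ d) (g e)"
proof -
  have c: "f i \<in> carrier R" "(shift ^^ i) g n \<in> carrier R" for i n
    using f(1) g(1) by (auto intro: mem_upD)
  have "bound \<zero> d f" using f(2) by (simp add: bound_def)
  then have "(f \<otimes>\<^bsub>Ore\<^esub> g) (d + e) = (\<Oplus>i\<in>{..d}. f i \<otimes> (shift ^^ i) g (d + e))"
    by (rule mult_eq[OF f(1) g(1)])
  also have "\<dots> = (\<Oplus>i\<in>{..d}. if d = i then f i \<otimes> (shift ^^ i) g (d + e) else \<zero>)"
  proof (rule add.finprod_cong')
    fix i assume "i \<in> {..d}"
    moreover have "(shift ^^ i) g (d + e) = \<zero>" if "i < d"
      using shift_pow_degree[OF g, of i] that by simp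
    ultimately show "f i \<otimes> (shift ^^ i) g (d + e) = (if d = i then f i \<otimes> (shift ^^ i) g (d + e) else \<zero>)"
      using c by (cases "i = d") auto
  qed (use c in auto)
  also have "\<dots> = f d \<otimes> (shift ^^ d) g (d + e)"
    using c by (intro add.finprod_singleton) auto
  finally show ?thesis
    using shift_pow_degree[OF g, of d] by (simp add: add.commute)
qed

lemma sigma_pow_closed [simp]: "a \<in> carrier R \<Longrightarrow> (\<sigma> ^^ l) a \<in> carrier R"
  by (induction l) auto

lemma sigma_pow_zero [simp]: "(\<sigma> ^^ l) \<zero> = \<zero>"
  by (induction l) auto

lemma sigma_pow_mult:
  "\<lbrakk>a \<in> carrier R; b \<in> carrier R\<rbrakk> \<Longrightarrow> (\<sigma> ^^ l) (a \<otimes> b) = (\<sigma> ^^ l) a \<otimes> (\<sigma> ^^ l) b"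
  by (induction l) auto

text \<open>All uses of injectivity of \<open>\<sigma>\<close> pass through here: leading
  coefficients survive multiplication by powers of \<open>x\<close>.\<close>

lemma sigma_pow_eq_zero:
  assumes "inj_on \<sigma> (carrier R)" and "a \<in> carrier R" "(\<sigma> ^^ l) a = \<zero>"
  shows "a = \<zero>"
  using assms(3)
proof (induction l)
  case (Suc l)
  then have "\<sigma> ((\<sigma> ^^ l) a) = \<sigma> \<zero>" by simp
  then show ?case
    using Suc.IH inj_onD[OF assms(1), of "(\<sigma> ^^ l) a" \<zero>] assms(2) by simp
qed simp

text \<open>Scalars act coefficientwise, so what annihilates \<open>w\<close> annihilates every
  coefficient.\<close>

lemma nonsingular_left_module_Ore:
  assumes ns: left_nonsingular
  shows "nonsingular_left_module R Ore (\<lambda>a f n. a \<otimes> f n)"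
proof (intro nonsingular_left_module.intro nonsingular_left_module_axioms.intro left_module_Ore ns)
  fix w assume w: "w \<in> carrier Ore" "left_essential {r \<in> carrier R. (\<lambda>n. r \<otimes> w n) = \<zero>\<^bsub>Ore\<^esub>}"
  have "w n = \<zero>" for n
  proof -
    have "{r \<in> carrier R. (\<lambda>n. r \<otimes> w n) = \<zero>\<^bsub>Ore\<^esub>} \<subseteq> {r \<in> carrier R. r \<otimes> w n = \<zero>}"
      by (auto simp: zero_Ore dest: fun_cong)
    moreover have "w n \<in> carrier R"
      using w(1) by (auto simp: carrier_Ore)
    ultimately show ?thesis
      using left_essential_mono[OF w(2)] ns unfolding left_nonsingular_def by blast
  qed
  then show "w = \<zero>\<^bsub>Ore\<^esub>"
    by (auto simp: zero_Ore)
qed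

text \<open>With coefficients on the left, \<open>a \<mapsto> a x^i\<close> is an injective
  \<open>R\<close>-linear map.\<close>

lemma uniform_scaled_pow:
  assumes u: "regular.uniform u"
  shows "poly.uniform (scaled_pow u i)"
  unfolding poly.uniform_def
proof (intro conjI ballI impI)
  have uR: "u \<in> carrier R" using u by (simp add: regular.uniform_def)
  have smult: "(\<lambda>n. r \<otimes> scaled_pow a i n) = scaled_pow (r \<otimes> a) i" if "r \<in> carrier R" for r a
    using that by auto
  have zero: "scaled_pow a i = \<zero>\<^bsub>Ore\<^esub> \<longleftrightarrow> a = \<zero>" for a
    by (auto simp: zero_Ore dest: fun_cong[of _ _ i])
  show "scaled_pow u i \<in> carrier Ore"
    using uR by (simp add: carrier_Ore up_monom)
  fix r s assume rs: "r \<in> carrier R" "s \<in> carrier R"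
    and "(\<lambda>n. r \<otimes> scaled_pow u i n) \<noteq> \<zero>\<^bsub>Ore\<^esub>" "(\<lambda>n. s \<otimes> scaled_pow u i n) \<noteq> \<zero>\<^bsub>Ore\<^esub>"
  then have "r \<otimes> u \<noteq> \<zero>" "s \<otimes> u \<noteq> \<zero>"
    by (simp_all only: smult zero not_False_eq_True)
  then obtain a b where "a \<in> carrier R" "b \<in> carrier R" "a \<otimes> (r \<otimes> u) = b \<otimes> (s \<otimes> u)"
    "a \<otimes> (r \<otimes> u) \<noteq> \<zero>"
    using u rs unfolding regular.uniform_def by blast
  then show "\<exists>a\<in>carrier R. \<exists>b\<in>carrier R.
      (\<lambda>n. a \<otimes> (r \<otimes> scaled_pow u i n)) = (\<lambda>n. b \<otimes> (s \<otimes> scaled_pow u i n)) \<and>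
      (\<lambda>n. a \<otimes> (r \<otimes> scaled_pow u i n)) \<noteq> \<zero>\<^bsub>Ore\<^esub>"
    using rs by (intro bexI[of _ a] bexI[of _ b])
      (simp_all only: smult[THEN fun_cong] smult zero, simp_all)
qed

text \<open>For a single power of \<open>x\<close>, pull \<open>N\<close> back to a left ideal of
  \<open>R\<close>, which contains \<open>U\<close> and so is dense; sums of monomials follow by
  induction on the degree.\<close>

lemma polys_subset_closure:
  assumes dense: "\<And>N. \<lbrakk>regular.submod N; U \<subseteq> N\<rbrakk> \<Longrightarrow> regular.closure N = carrier R"
    and N: "poly.submod N" "\<And>u i. \<lbrakk>u \<in> U; i \<le> m\<rbrakk> \<Longrightarrow> scaled_pow u i \<in> N"
    and U: "U \<subseteq> carrier R"
  shows "polys m \<subseteq> poly.closure N"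
proof -
  have mono: "scaled_pow a i \<in> poly.closure N" if a: "a \<in> carrier R" and i: "i \<le> m" for a i
  proof -
    define L where "L = {a \<in> carrier R. scaled_pow a i \<in> N}"
    have "regular.submod L"
      unfolding regular.submod_def
    proof (intro conjI ballI)
      show "\<zero> \<in> L"
        using poly.submodD(2)[OF N(1)] by (simp add: L_def zero_Ore if_distrib cong: if_cong)
      show "v \<oplus> w \<in> L" if "v \<in> L" "w \<in> L" for v w
      proof -
        have "scaled_pow (v \<oplus> w) i = scaled_pow v i \<oplus>\<^bsub>Ore\<^esub> scaled_pow w i"
          using that by (auto simp: L_def add_Ore up_monom)
        then show ?thesis
          using poly.submodD(3)[OF N(1)] that by (simp add: L_def)
      qed
      show "b \<otimes> v \<in> L" if "b \<in> carrier R" "v \<in> L" for b v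
      proof -
        have "scaled_pow (b \<otimes> v) i = (\<lambda>n. b \<otimes> scaled_pow v i n)"
          using that by auto
        then show ?thesis
          using poly.submodD(4)[OF N(1)] that by (simp add: L_def)
      qed
    qed (auto simp: L_def)
    moreover have "U \<subseteq> L"
      using N(2) i U by (auto simp: L_def)
    ultimately have "a \<in> regular.closure L"
      using dense a by simp
    then have "left_essential {r \<in> carrier R. r \<otimes> a \<in> L}"
      by (simp add: regular.closure_def)
    moreover have "{r \<in> carrier R. r \<otimes> a \<in> L} \<subseteq> {r \<in> carrier R. (\<lambda>n. r \<otimes> scaled_pow a i n) \<in> N}"
    proof clarify
      fix r assume "r \<in> carrier R" "r \<otimes> a \<in> L"
      moreover have "scaled_pow (r \<otimes> a) i = (\<lambda>n. r \<otimes> scaled_pow a i n)"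
        using \<open>r \<in> carrier R\<close> by auto
      ultimately show "(\<lambda>n. r \<otimes> scaled_pow a i n) \<in> N"
        by (simp add: L_def)
    qed
    ultimately show ?thesis
      using a left_essential_mono unfolding poly.closure_def by (simp add: carrier_Ore up_monom)
  qed
  have "polys k \<subseteq> poly.closure N" if "k \<le> m" for k
    using that
  proof (induction k)
    case 0
    show ?case
    proof
      fix f assume f: "f \<in> polys 0"
      then have "f = scaled_pow (f 0) 0" by (auto simp: polys_def)
      then show "f \<in> poly.closure N"
        using mono[of "f 0" 0] f by (auto simp: polys_def)
    qed
  next
    case (Suc k)
    show ?case
    proof
      fix f assume f: "f \<in> polys (Suc k)"
      let ?g = "\<lambda>n. if n = Suc k then \<zero> else f n"
      have fR: "f n \<in> carrier R" for n using f by (auto simp: polys_def)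
      have "\<forall>n>k. ?g n = \<zero>"
        using f by (auto simp: polys_def)
      moreover have "?g \<in> up R"
        using fR \<open>\<forall>n>k. ?g n = \<zero>\<close> by (intro mem_upI exI[of _ k]) (auto simp: bound_def)
      ultimately have g: "?g \<in> polys k" "?g \<in> up R" by (simp_all add: polys_def)
      have "f = ?g \<oplus>\<^bsub>Ore\<^esub> scaled_pow (f (Suc k)) (Suc k)"
        using g fR by (auto simp: add_Ore up_monom)
      moreover have "?g \<oplus>\<^bsub>Ore\<^esub> scaled_pow (f (Suc k)) (Suc k) \<in> poly.closure N"
        using g Suc mono fR by (intro poly.submodD(3)[OF poly.closure_submod[OF N(1)]]) auto
      ultimately show "f \<in> poly.closure N" by simp
    qed
  qed
  then show ?thesis by simp
qed

section \<open>Homomorphisms on left ideals of the Ore extension and chain lengths\<close>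

text \<open>The left \<open>S\<close>-submodule \<open>\<Phi>\<close> of \<open>B \<times> S\<close>, where \<open>S\<close> is the Ore extension, is the graph of a
  nonzero homomorphism from a submodule of \<open>B\<close> that contains \<open>A\<close> in its kernel. For sums of left
  ideals it is a projection, for left annihilators a right multiplication.\<close>

definition separated :: "(nat \<Rightarrow> 'a) set \<Rightarrow> (nat \<Rightarrow> 'a) set \<Rightarrow> bool" where
  "separated A B \<longleftrightarrow> poly.submod A \<and> poly.submod B \<and>
     (\<exists>\<Phi>. \<Phi> \<subseteq> B \<times> up R \<and>
       (\<forall>(f, g)\<in>\<Phi>. \<forall>(f', g')\<in>\<Phi>. (f \<oplus>\<^bsub>Ore\<^esub> f', g \<oplus>\<^bsub>Ore\<^esub> g') \<in> \<Phi>) \<and>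
       (\<forall>s\<in>up R. \<forall>(f, g)\<in>\<Phi>. (s \<otimes>\<^bsub>Ore\<^esub> f, s \<otimes>\<^bsub>Ore\<^esub> g) \<in> \<Phi>) \<and>
       (\<forall>a\<in>A. (a, \<zero>\<^bsub>Ore\<^esub>) \<in> \<Phi>) \<and> (\<forall>g. (\<zero>\<^bsub>Ore\<^esub>, g) \<in> \<Phi> \<longrightarrow> g = \<zero>\<^bsub>Ore\<^esub>) \<and>
       (\<exists>(f, g)\<in>\<Phi>. g \<noteq> \<zero>\<^bsub>Ore\<^esub>))"

text \<open>If \<open>(f, g) \<in> \<Phi>\<close> with \<open>g \<noteq> 0\<close>, the \<open>m + 1 - deg f\<close> pairs \<open>(x\<^sup>l f, x\<^sup>l g)\<close> with
  \<open>deg (x\<^sup>l f) \<le> m\<close> have second components of distinct degrees.\<close>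

lemma separated_chain:
  assumes ns: left_nonsingular and inj: "inj_on \<sigma> (carrier R)" and AB: "separated A B"
  obtains c where "\<And>m. c \<le> m \<Longrightarrow> poly.chain (A \<inter> polys m) (m + 1 - c) (B \<inter> polys m)"
proof -
  obtain \<Phi> where A: "poly.submod A" and B: "poly.submod B" and sub': "\<Phi> \<subseteq> B \<times> up R"
    and add': "\<forall>(f, g)\<in>\<Phi>. \<forall>(f', g')\<in>\<Phi>. (f \<oplus>\<^bsub>Ore\<^esub> f', g \<oplus>\<^bsub>Ore\<^esub> g') \<in> \<Phi>"
    and mult': "\<forall>s\<in>up R. \<forall>(f, g)\<in>\<Phi>. (s \<otimes>\<^bsub>Ore\<^esub> f, s \<otimes>\<^bsub>Ore\<^esub> g) \<in> \<Phi>"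
    and ker': "\<forall>a\<in>A. (a, \<zero>\<^bsub>Ore\<^esub>) \<in> \<Phi>" and func': "\<forall>g. (\<zero>\<^bsub>Ore\<^esub>, g) \<in> \<Phi> \<longrightarrow> g = \<zero>\<^bsub>Ore\<^esub>"
    and nz: "\<exists>(f, g)\<in>\<Phi>. g \<noteq> \<zero>\<^bsub>Ore\<^esub>"
    using AB unfolding separated_def by (elim conjE exE) (rule that)
  obtain f0 g0 where fg0: "(f0, g0) \<in> \<Phi>" "g0 \<noteq> \<zero>\<^bsub>Ore\<^esub>"
    using nz by auto
  have sub: "f \<in> B \<and> g \<in> up R" if "(f, g) \<in> \<Phi>" for f g
    using sub' that by auto
  have add: "(f \<oplus>\<^bsub>Ore\<^esub> f', g \<oplus>\<^bsub>Ore\<^esub> g') \<in> \<Phi>" if "(f, g) \<in> \<Phi>" "(f', g') \<in> \<Phi>" for f g f' g'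
    using bspec[OF add' that(1)] that(2) by auto
  have mult: "(s \<otimes>\<^bsub>Ore\<^esub> f, s \<otimes>\<^bsub>Ore\<^esub> g) \<in> \<Phi>" if "s \<in> up R" "(f, g) \<in> \<Phi>" for s f g
    using bspec[OF bspec[OF mult' that(1)] that(2)] by simp
  have ker: "(a, \<zero>\<^bsub>Ore\<^esub>) \<in> \<Phi>" if "a \<in> A" for a
    using ker' that by blast
  have func: "g = \<zero>\<^bsub>Ore\<^esub>" if "(\<zero>\<^bsub>Ore\<^esub>, g) \<in> \<Phi>" for g
    using func' that by blast
  interpret S: ring Ore by (rule ring_Ore)
  have BR: "B \<subseteq> up R" using B by (auto simp: poly.submod_def carrier_Ore)
  have f0: "f0 \<in> up R" and g0: "g0 \<in> up R" using sub[OF fg0(1)] BR by auto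
  obtain c where c: "bound \<zero> c f0" using f0 by blast
  then have c: "\<forall>n>c. f0 n = \<zero>" by (simp add: bound_def)
  obtain e where e: "g0 e \<noteq> \<zero>" "\<forall>n>e. g0 n = \<zero>"
    using nonzero_degree[OF g0] fg0(2) by (auto simp: zero_Ore)
  have smult: "((\<lambda>n. r \<otimes> f n), (\<lambda>n. r \<otimes> g n)) \<in> \<Phi>" if r: "r \<in> carrier R" and fg: "(f, g) \<in> \<Phi>" for r f g
    using mult[OF up_monom[OF r, of 0] fg] sub[OF fg] BR r by (simp add: scaled_pow_mult(1) subset_iff)
  \<comment> \<open>\<open>\<Phi>\<close> is single-valued: subtract two pairs by means of the
    scalar \<open>-1\<close> of \<open>S\<close> and apply \<open>func\<close>.\<close>
  have diff: "g = g'" if "(f, g) \<in> \<Phi>" "(f, g') \<in> \<Phi>" for f g g'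
  proof -
    have fR: "f \<in> carrier Ore" and gR: "g \<in> carrier Ore" "g' \<in> carrier Ore"
      using that[THEN sub] BR by (auto simp: carrier_Ore)
    have "(\<ominus>\<^bsub>Ore\<^esub> \<one>\<^bsub>Ore\<^esub> \<otimes>\<^bsub>Ore\<^esub> f, \<ominus>\<^bsub>Ore\<^esub> \<one>\<^bsub>Ore\<^esub> \<otimes>\<^bsub>Ore\<^esub> g') \<in> \<Phi>"
      using mult[of "\<ominus>\<^bsub>Ore\<^esub> \<one>\<^bsub>Ore\<^esub>" f g'] that(2) poly.M.add.inv_closed[OF S.one_closed] by (simp add: carrier_Ore)
    then have "(\<ominus>\<^bsub>Ore\<^esub> f, \<ominus>\<^bsub>Ore\<^esub> g') \<in> \<Phi>"
      using fR gR by (simp add: S.l_minus)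
    then have "(f \<oplus>\<^bsub>Ore\<^esub> \<ominus>\<^bsub>Ore\<^esub> f, g \<oplus>\<^bsub>Ore\<^esub> \<ominus>\<^bsub>Ore\<^esub> g') \<in> \<Phi>"
      using add that(1) by blast
    then have "g \<oplus>\<^bsub>Ore\<^esub> \<ominus>\<^bsub>Ore\<^esub> g' = \<zero>\<^bsub>Ore\<^esub>"
      using func fR by (simp add: poly.M.r_neg)
    then show ?thesis
      using gR poly.M.minus_equality[of g "\<ominus>\<^bsub>Ore\<^esub> g'"] by simp
  qed
  have chain: "poly.chain (A \<inter> polys m) (m + 1 - c) (B \<inter> polys m)" if "c \<le> m" for m
  proof -
    \<comment> \<open>The domain of \<open>\<Phi>\<close> is filtered by the degree of the image,
      not of the argument. Elements of \<open>A\<close> have the image zero, so those of degree at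
      most \<open>m\<close> lie in every \<open>L l\<close>.\<close>
    define L where "L l = {f \<in> polys m. \<exists>g. (f, g) \<in> \<Phi> \<and> (\<forall>n\<ge>l. g n = \<zero>)}" for l
    have L_B: "L l \<subseteq> B \<inter> polys m" for l
      using sub by (auto simp: L_def)
    have L_submod: "poly.submod (L l)" for l
      unfolding poly.submod_def
    proof (intro conjI ballI)
      show "L l \<subseteq> carrier Ore" using L_B BR by (auto simp: carrier_Ore)
      show "\<zero>\<^bsub>Ore\<^esub> \<in> L l"
        using ker poly.submodD(2)[OF A] poly.submodD(2)[OF polys_submod]
        by (auto simp: L_def zero_Ore)
      show "v \<oplus>\<^bsub>Ore\<^esub> w \<in> L l" if vw: "v \<in> L l" "w \<in> L l" for v w
      proof -
        obtain g g' where g: "(v, g) \<in> \<Phi>" "\<forall>n\<ge>l. g n = \<zero>" "(w, g') \<in> \<Phi>" "\<forall>n\<ge>l. g' n = \<zero>"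
          using vw by (auto simp: L_def)
        have "\<forall>n\<ge>l. (g \<oplus>\<^bsub>Ore\<^esub> g') n = \<zero>"
          using g sub by (simp add: add_Ore)
        then show ?thesis
          using add[OF g(1,3)] vw poly.submodD(3)[OF polys_submod] by (auto simp: L_def)
      qed
      show "(\<lambda>n. r \<otimes> v n) \<in> L l" if r: "r \<in> carrier R" and v: "v \<in> L l" for r v
      proof -
        obtain g where g: "(v, g) \<in> \<Phi>" "\<forall>n\<ge>l. g n = \<zero>"
          using v by (auto simp: L_def)
        then have "\<forall>n\<ge>l. r \<otimes> g n = \<zero>"
          using r by simp
        then show ?thesis
          using smult[OF r g(1)] v r poly.submodD(4)[OF polys_submod] by (auto simp: L_def)
      qed
    qed
    \<comment> \<open>The offset \<open>e\<close> is the degree of \<open>g0\<close>: the image of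
      \<open>x^l f0\<close> has degree exactly \<open>e + l\<close>, so \<open>x^l f0\<close>
      belongs to \<open>L (e + Suc l)\<close> but not to \<open>L (e + l)\<close>.\<close>
    have "poly.chain (A \<inter> polys m) l (L (e + l))" if "l \<le> m + 1 - c" for l
      using that
    proof (induction l)
      case 0
      have "A \<inter> polys m \<subseteq> L (e + 0)"
        using ker by (auto simp: L_def zero_Ore)
      then show ?case
        using poly.chain_0[OF submod_Int_polys[OF A] L_submod] by blast
    next
      case (Suc l)
      let ?f = "(shift ^^ l) f0" and ?g = "(shift ^^ l) g0"
      have fg: "(?f, ?g) \<in> \<Phi>"
        using mult[OF up_monom[OF one_closed, of l] fg0(1)] by (simp add: scaled_pow_mult(2) f0 g0)
      have g: "\<forall>n>e + l. ?g n = \<zero>" "?g (e + l) = (\<sigma> ^^ l) (g0 e)"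
        using shift_pow_degree[OF g0 e(2), of l] by auto
      have "?f \<in> polys m"
        using shift_pow_degree[OF f0 c, of l] Suc.prems f0 by (auto simp: polys_def)
      then have fL: "?f \<in> L (e + Suc l)"
        using fg g(1) by (auto simp: L_def)
      have "?f \<notin> poly.closure (L (e + l))"
      proof
        assume "?f \<in> poly.closure (L (e + l))"
        then have ess: "left_essential {r \<in> carrier R. (\<lambda>n. r \<otimes> ?f n) \<in> L (e + l)}"
          by (simp add: poly.closure_def)
        \<comment> \<open>The image of \<open>r x^l f0\<close> can only be \<open>r x^l g0\<close>;
          if its coefficient at \<open>e + l\<close> is zero, \<open>r\<close> annihilates the
          leading coefficient of \<open>x^l g0\<close>.\<close>
        have "{r \<in> carrier R. (\<lambda>n. r \<otimes> ?f n) \<in> L (e + l)}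
            \<subseteq> {r \<in> carrier R. r \<otimes> (\<sigma> ^^ l) (g0 e) = \<zero>}"
        proof clarify
          fix r assume r: "r \<in> carrier R" "(\<lambda>n. r \<otimes> ?f n) \<in> L (e + l)"
          then obtain g' where "((\<lambda>n. r \<otimes> ?f n), g') \<in> \<Phi>" "\<forall>n\<ge>e + l. g' n = \<zero>"
            by (auto simp: L_def)
          moreover from this have "g' = (\<lambda>n. r \<otimes> ?g n)"
            using diff smult[OF r(1) fg] by blast
          ultimately show "r \<otimes> (\<sigma> ^^ l) (g0 e) = \<zero>"
            using g(2) by auto
        qed
        then have "(\<sigma> ^^ l) (g0 e) = \<zero>"
          using left_essential_mono[OF ess] ns mem_upD[OF g0] unfolding left_nonsingular_def
          by (meson sigma_pow_closed)
        then show False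
          using sigma_pow_eq_zero[OF inj _] mem_upD[OF g0] e(1) by blast
      qed
      moreover have "L (e + l) \<subseteq> L (e + Suc l)"
        by (auto simp: L_def)
      ultimately show ?case
        using poly.chain_Suc[OF _ L_submod _ fL] Suc by simp
    qed
    then show ?thesis
      using poly.chain_weaken[OF _ L_B submod_Int_polys[OF B]] by blast
  qed
  then show thesis by (rule that)
qed

text \<open>In degrees at most \<open>m\<close> every separated step contributes \<open>m - O(1)\<close> to the length of a chain of
  \<open>R\<close>-submodules, while the uniform dimension is at most \<open>(m + 1) n\<close>, with \<open>n\<close> that of \<open>R\<close>;
  hence there are at most \<open>n\<close> steps.\<close>

lemma no_separated_sequence:
  assumes ns: left_nonsingular and fin: "finite_left_uniform_dim R" and inj: "inj_on \<sigma> (carrier R)"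
    and A: "\<And>t::nat. separated (A t) (A (Suc t))"
  shows False
proof -
  interpret poly: nonsingular_left_module R "ore_extension R \<sigma> \<delta>" "\<lambda>a f n. a \<otimes> f n"
    by (rule nonsingular_left_module_Ore[OF ns])
  obtain U where U: "finite U" "\<And>u. u \<in> U \<Longrightarrow> regular.uniform u"
    and dense: "\<And>N. \<lbrakk>regular.submod N; U \<subseteq> N\<rbrakk> \<Longrightarrow> regular.closure N = carrier R"
    using ex_dense_uniform_set[OF ns fin] by auto
  have UR: "U \<subseteq> carrier R" using U(2) by (auto simp: regular.uniform_def)
  have "\<exists>c. \<forall>m\<ge>c. poly.chain (A t \<inter> polys m) (m + 1 - c) (A (Suc t) \<inter> polys m)" for t
    using separated_chain[OF ns inj A[of t]] by metis
  then obtain c where c: "\<And>t m. c t \<le> m \<Longrightarrow> poly.chain (A t \<inter> polys m) (m + 1 - c t) (A (Suc t) \<inter> polys m)"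
    by metis
  \<comment> \<open>\<open>C\<close> bounds every loss \<open>c t\<close> with \<open>t < k\<close>,
    so the chain has at least \<open>k (m + 1 - C)\<close> steps. Against the bound
    \<open>(k - 1) (m + 1)\<close> this would force \<open>m + 1 \<le> k C\<close>, which fails for
    \<open>m = k C\<close>.\<close>
  define k where "k = Suc (card U)"
  define C where "C = (\<Sum>t<k. c t)"
  define m where "m = k * C"
  have cC: "c t \<le> C" if "t < k" for t
    unfolding C_def using that by (intro member_le_sum) auto
  have Cm: "C \<le> m" by (simp add: m_def k_def)
  have sub: "poly.submod (A t)" for t
    using A[of t] by (simp add: separated_def)
  have chain: "poly.chain (A 0 \<inter> polys m) (\<Sum>t<l. m + 1 - c t) (A l \<inter> polys m)" if "l \<le> k" for l
    using that
  proof (induction l)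
    case 0
    show ?case using poly.chain_0[of "A 0 \<inter> polys m" "A 0 \<inter> polys m"] submod_Int_polys[OF sub] by simp
  next
    case (Suc l)
    then have "c l \<le> m" using cC[of l] Cm by simp
    then show ?case
      using poly.chain_trans[OF c[of l m]] Suc by simp
  qed
  define W where "W = (\<lambda>(u, i). scaled_pow u i) ` (U \<times> {..m})"
  have "(\<Sum>t<k. m + 1 - c t) \<le> card W"
  proof (rule poly.chain_length_le[OF chain[OF order_refl], where V = "polys m"])
    show "finite W" using U(1) by (simp add: W_def)
    show "W \<subseteq> polys m" using UR by (auto simp: W_def polys_def up_monom)
    show "poly.uniform w" if "w \<in> W" for w
      using that U(2) uniform_scaled_pow by (auto simp: W_def)
    show "polys m \<subseteq> poly.closure N" if "poly.submod N" "W \<subseteq> N" for N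
      using that by (intro polys_subset_closure[OF dense _ _ UR]) (auto simp: W_def)
  qed (simp_all add: polys_submod)
  also have "\<dots> \<le> card U * (m + 1)"
    using card_image_le[of "U \<times> {..m}" "\<lambda>(u, i). scaled_pow u i"] U(1)
    by (simp add: W_def card_cartesian_product)
  finally have "(\<Sum>t<k. m + 1 - c t) \<le> card U * (m + 1)" .
  moreover have "k * (m + 1 - C) \<le> (\<Sum>t<k. m + 1 - c t)"
    using sum_mono[of "{..<k}" "\<lambda>_. m + 1 - C" "\<lambda>t. m + 1 - c t"] cC by (simp add: diff_le_mono2)
  moreover have "k * (m + 1 - C) + k * C = k * (m + 1)"
    using Cm by (simp flip: distrib_left)
  ultimately show False
    by (simp add: m_def k_def)
qed

section \<open>Left annihilators in the Ore extension\<close>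

lemma submodI:
  assumes "N \<subseteq> up R" "\<zero>\<^bsub>Ore\<^esub> \<in> N" "\<And>f g. \<lbrakk>f \<in> N; g \<in> N\<rbrakk> \<Longrightarrow> f \<oplus>\<^bsub>Ore\<^esub> g \<in> N"
    and mult: "\<And>s f. \<lbrakk>s \<in> up R; f \<in> N\<rbrakk> \<Longrightarrow> s \<otimes>\<^bsub>Ore\<^esub> f \<in> N"
  shows "poly.submod N"
  unfolding poly.submod_def
proof (intro conjI ballI)
  show "(\<lambda>n. r \<otimes> f n) \<in> N" if "r \<in> carrier R" "f \<in> N" for r f
    using mult[OF up_monom[OF that(1), of 0] that(2)] scaled_pow_mult(1)[of f r] assms(1) that
    by (simp add: subset_iff)
qed (use assms in \<open>auto simp: carrier_Ore\<close>)

lemma submod_left_annihilator: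
  assumes X: "X \<subseteq> up R"
  shows "poly.submod (left_annihilator Ore X)"
proof -
  interpret S: ring Ore by (rule ring_Ore)
  show ?thesis
  proof (rule submodI)
    show "s \<otimes>\<^bsub>Ore\<^esub> f \<in> left_annihilator Ore X" if "s \<in> up R" "f \<in> left_annihilator Ore X" for s f
      using that X by (auto simp: left_annihilator_def carrier_Ore[symmetric] S.m_assoc subset_iff)
    show "f \<oplus>\<^bsub>Ore\<^esub> g \<in> left_annihilator Ore X"
      if "f \<in> left_annihilator Ore X" "g \<in> left_annihilator Ore X" for f g
      using that X by (auto simp: left_annihilator_def carrier_Ore[symmetric] S.l_distr subset_iff)
    show "\<zero>\<^bsub>Ore\<^esub> \<in> left_annihilator Ore X"
      using X by (auto simp: left_annihilator_def carrier_Ore[symmetric] subset_iff)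
  qed (auto simp: left_annihilator_def carrier_Ore)
qed

lemma separated_left_annihilators:
  assumes X: "X \<subseteq> up R" and Y: "Y \<subseteq> up R"
    and less: "left_annihilator Ore X \<subset> left_annihilator Ore Y"
  shows "separated (left_annihilator Ore X) (left_annihilator Ore Y)"
proof -
  interpret S: ring Ore by (rule ring_Ore)
  let ?A = "left_annihilator Ore X" and ?B = "left_annihilator Ore Y"
  have BR: "?B \<subseteq> up R" by (auto simp: left_annihilator_def carrier_Ore)
  have B: "poly.submod ?B" by (rule submod_left_annihilator[OF Y])
  obtain f where f: "f \<in> ?B" "f \<notin> ?A" using less by blast
  \<comment> \<open>Right multiplication by \<open>s\<close> kills the smaller annihilator, because
    \<open>s\<close> is in \<open>X\<close>, but not \<open>f\<close>.\<close>
  then obtain s where s: "s \<in> X" "f \<otimes>\<^bsub>Ore\<^esub> s \<noteq> \<zero>\<^bsub>Ore\<^esub>"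
    by (auto simp: left_annihilator_def)
  have sR: "s \<in> up R" using s X by blast
  define \<Phi> where "\<Phi> = (\<lambda>g. (g, g \<otimes>\<^bsub>Ore\<^esub> s)) ` ?B"
  have "\<Phi> \<subseteq> ?B \<times> up R"
    using BR sR by (auto simp: \<Phi>_def mult_closed subset_iff)
  moreover have "\<forall>(f, g)\<in>\<Phi>. \<forall>(f', g')\<in>\<Phi>. (f \<oplus>\<^bsub>Ore\<^esub> f', g \<oplus>\<^bsub>Ore\<^esub> g') \<in> \<Phi>"
  proof clarify
    fix f g f' g' assume "(f, g) \<in> \<Phi>" "(f', g') \<in> \<Phi>"
    then have "f \<in> ?B" "f' \<in> ?B" "g = f \<otimes>\<^bsub>Ore\<^esub> s" "g' = f' \<otimes>\<^bsub>Ore\<^esub> s"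
      by (auto simp: \<Phi>_def)
    moreover from this have "g \<oplus>\<^bsub>Ore\<^esub> g' = (f \<oplus>\<^bsub>Ore\<^esub> f') \<otimes>\<^bsub>Ore\<^esub> s"
      using BR sR S.l_distr[of f f' s] by (simp add: carrier_Ore subset_iff)
    ultimately show "(f \<oplus>\<^bsub>Ore\<^esub> f', g \<oplus>\<^bsub>Ore\<^esub> g') \<in> \<Phi>"
      using poly.submodD(3)[OF B] by (simp add: \<Phi>_def)
  qed
  moreover have "\<forall>t\<in>up R. \<forall>(f, g)\<in>\<Phi>. (t \<otimes>\<^bsub>Ore\<^esub> f, t \<otimes>\<^bsub>Ore\<^esub> g) \<in> \<Phi>"
  proof clarify
    fix t f g assume t: "t \<in> up R" and "(f, g) \<in> \<Phi>"
    then have f: "f \<in> ?B" "g = f \<otimes>\<^bsub>Ore\<^esub> s"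
      by (auto simp: \<Phi>_def)
    have "t \<otimes>\<^bsub>Ore\<^esub> f \<in> ?B"
      using f(1) t Y mult_closed mult_assoc S.r_null
      by (auto simp: left_annihilator_def carrier_Ore subset_iff)
    moreover have "t \<otimes>\<^bsub>Ore\<^esub> g = (t \<otimes>\<^bsub>Ore\<^esub> f) \<otimes>\<^bsub>Ore\<^esub> s"
      using f BR sR t mult_assoc by auto
    ultimately show "(t \<otimes>\<^bsub>Ore\<^esub> f, t \<otimes>\<^bsub>Ore\<^esub> g) \<in> \<Phi>"
      by (simp add: \<Phi>_def)
  qed
  moreover have "\<forall>a\<in>?A. (a, \<zero>\<^bsub>Ore\<^esub>) \<in> \<Phi>"
  proof
    fix a assume a: "a \<in> ?A"
    then have "a \<in> ?B" "a \<otimes>\<^bsub>Ore\<^esub> s = \<zero>\<^bsub>Ore\<^esub>"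
      using less s(1) by (auto simp: left_annihilator_def)
    then show "(a, \<zero>\<^bsub>Ore\<^esub>) \<in> \<Phi>"
      by (auto simp: \<Phi>_def intro!: image_eqI[of _ _ a])
  qed
  moreover have "\<forall>g. (\<zero>\<^bsub>Ore\<^esub>, g) \<in> \<Phi> \<longrightarrow> g = \<zero>\<^bsub>Ore\<^esub>"
    using sR by (auto simp: \<Phi>_def carrier_Ore[symmetric])
  moreover have "\<exists>(f, g)\<in>\<Phi>. g \<noteq> \<zero>\<^bsub>Ore\<^esub>"
    using f(1) s(2) by (auto simp: \<Phi>_def)
  ultimately show ?thesis
    unfolding separated_def using submod_left_annihilator[OF X] B by blast
qed

lemma acc_left_annihilators_Ore:
  assumes ns: left_nonsingular and fin: "finite_left_uniform_dim R" and inj: "inj_on \<sigma> (carrier R)"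
  shows "acc_left_annihilators Ore"
  unfolding acc_left_annihilators_def
proof (intro allI impI)
  fix C :: "nat \<Rightarrow> (nat \<Rightarrow> 'a) set"
  assume C: "\<forall>n. \<exists>S\<subseteq>carrier Ore. C n = left_annihilator Ore S" and mono: "\<forall>n. C n \<subseteq> C (Suc n)"
  show "\<exists>N. \<forall>n\<ge>N. C n = C N"
  proof (rule ccontr)
    assume "\<not> ?thesis"
    \<comment> \<open>\<open>h\<close> jumps to a later index at which the chain has grown; its
      iterates select a strictly increasing subsequence.\<close>
    then obtain h where h: "h N \<ge> N" "C (h N) \<noteq> C N" for N by metis
    define A where "A t = C ((h ^^ t) 0)" for t
    have "separated (A t) (A (Suc t))" for t
    proof -
      have "A t \<subset> A (Suc t)"
        using h[of "(h ^^ t) 0"] lift_Suc_mono_le[of C] mono by (simp add: A_def psubset_eq)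
      moreover obtain X where "X \<subseteq> carrier Ore" "A t = left_annihilator Ore X"
        using C unfolding A_def by blast
      moreover obtain Y where "Y \<subseteq> carrier Ore" "A (Suc t) = left_annihilator Ore Y"
        using C unfolding A_def by blast
      ultimately show ?thesis
        using separated_left_annihilators[of X Y] by (simp add: carrier_Ore)
    qed
    then show False
      by (rule no_separated_sequence[OF ns fin inj])
  qed
qed

section \<open>Direct sums of left ideals in the Ore extension\<close>

lemma finite_left_uniform_dim_Ore:
  assumes ns: left_nonsingular and fin: "finite_left_uniform_dim R" and inj: "inj_on \<sigma> (carrier R)"
  shows "finite_left_uniform_dim Ore"
  unfolding finite_left_uniform_dim_def
proof
  assume "\<exists>\<J>. infinite \<J> \<and> (\<forall>J\<in>\<J>. J \<noteq> {\<zero>\<^bsub>Ore\<^esub>}) \<and> direct_left_ideals Ore \<J>"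
  then obtain \<J> where \<J>: "infinite \<J>" "\<forall>J\<in>\<J>. J \<noteq> {\<zero>\<^bsub>Ore\<^esub>}" and dir: "direct_left_ideals Ore \<J>"
    by blast
  interpret S: ring Ore by (rule ring_Ore)
  obtain X :: "nat \<Rightarrow> _" where X: "inj X" "range X \<subseteq> \<J>"
    using infinite_countable_subset[OF \<J>(1)] by blast
  have ideal: "J \<subseteq> up R" "\<zero>\<^bsub>Ore\<^esub> \<in> J" "\<lbrakk>f \<in> J; g \<in> J\<rbrakk> \<Longrightarrow> f \<oplus>\<^bsub>Ore\<^esub> g \<in> J"
    "\<lbrakk>s \<in> up R; f \<in> J\<rbrakk> \<Longrightarrow> s \<otimes>\<^bsub>Ore\<^esub> f \<in> J" if "J \<in> \<J>" for J f g s
  proof -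
    interpret J: left_ideal J Ore
      using dir that by (simp add: direct_left_ideals_def)
    show "J \<subseteq> up R" using J.a_subset by (simp add: carrier_Ore)
    show "\<zero>\<^bsub>Ore\<^esub> \<in> J" by (rule J.zero_closed)
    show "\<lbrakk>f \<in> J; g \<in> J\<rbrakk> \<Longrightarrow> f \<oplus>\<^bsub>Ore\<^esub> g \<in> J" by (rule J.a_closed)
    show "\<lbrakk>s \<in> up R; f \<in> J\<rbrakk> \<Longrightarrow> s \<otimes>\<^bsub>Ore\<^esub> f \<in> J" using J.I_l_closed by (simp add: carrier_Ore)
  qed
  define F where "F t = X ` {..<t}" for t
  have F: "finite (F t)" "F t \<subseteq> \<J>" "F (Suc t) = insert (X t) (F t)" "X t \<notin> F t" "X t \<in> \<J>" for t
    using X by (auto simp: F_def lessThan_Suc inj_eq)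
  define A where "A t = {finsum Ore y (F t) | y. y \<in> (\<Pi> J\<in>F t. J)}" for t
  have y_carrier: "y \<in> F t \<rightarrow> carrier Ore" if "y \<in> (\<Pi> J\<in>F t. J)" for y t
    using that F(2)[of t] ideal(1) by (auto simp: carrier_Ore Pi_iff subset_iff)
  have A_R: "A t \<subseteq> up R" for t
    using poly.M.finsum_closed[OF y_carrier] unfolding A_def by (auto simp: carrier_Ore)
  have A_zero: "\<zero>\<^bsub>Ore\<^esub> \<in> A t" for t
  proof -
    have "finsum Ore (\<lambda>_. \<zero>\<^bsub>Ore\<^esub>) (F t) = \<zero>\<^bsub>Ore\<^esub>" by simp
    moreover have "(\<lambda>_. \<zero>\<^bsub>Ore\<^esub>) \<in> (\<Pi> J\<in>F t. J)" using ideal(2) F(2)[of t] by auto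
    ultimately show ?thesis unfolding A_def by (metis (mono_tags, lifting) mem_Collect_eq)
  qed
  have A_add: "f \<oplus>\<^bsub>Ore\<^esub> g \<in> A t" if fg: "f \<in> A t" "g \<in> A t" for f g t
  proof -
    obtain y z where y: "y \<in> (\<Pi> J\<in>F t. J)" "f = finsum Ore y (F t)"
      and z: "z \<in> (\<Pi> J\<in>F t. J)" "g = finsum Ore z (F t)"
      using fg unfolding A_def by blast
    have "f \<oplus>\<^bsub>Ore\<^esub> g = finsum Ore (\<lambda>J. y J \<oplus>\<^bsub>Ore\<^esub> z J) (F t)"
      using y z y_carrier by (simp add: poly.M.finsum_addf)
    moreover have "(\<lambda>J. y J \<oplus>\<^bsub>Ore\<^esub> z J) \<in> (\<Pi> J\<in>F t. J)"
      using y(1) z(1) ideal(3) F(2)[of t] by (simp add: Pi_iff subset_iff)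
    ultimately show ?thesis unfolding A_def by blast
  qed
  have A_mult: "s \<otimes>\<^bsub>Ore\<^esub> f \<in> A t" if s: "s \<in> up R" and f: "f \<in> A t" for s f t
  proof -
    obtain y where y: "y \<in> (\<Pi> J\<in>F t. J)" "f = finsum Ore y (F t)"
      using f unfolding A_def by blast
    have "s \<otimes>\<^bsub>Ore\<^esub> f = finsum Ore (\<lambda>J. s \<otimes>\<^bsub>Ore\<^esub> y J) (F t)"
      using y y_carrier F(1) s by (simp add: S.finsum_rdistr carrier_Ore)
    moreover have "(\<lambda>J. s \<otimes>\<^bsub>Ore\<^esub> y J) \<in> (\<Pi> J\<in>F t. J)"
      using y(1) s ideal(4) F(2)[of t] by (simp add: Pi_iff subset_iff)
    ultimately show ?thesis unfolding A_def by blast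
  qed
  have A_submod: "poly.submod (A t)" for t
    by (rule submodI[OF A_R A_zero A_add A_mult])
  \<comment> \<open>A single choice function serves two purposes: it puts the sum of
    \<open>a\<close> and \<open>y\<close> into \<open>A (Suc t)\<close>, and when that sum is zero,
    directness applied to it gives \<open>y = 0\<close>.\<close>
  have sum_insert: "\<exists>z. z \<in> (\<Pi> J\<in>F (Suc t). J) \<and> finsum Ore z (F (Suc t)) = a \<oplus>\<^bsub>Ore\<^esub> y \<and> z (X t) = y"
    if a: "a \<in> A t" and y: "y \<in> X t" for a y t
  proof -
    obtain z where z: "z \<in> (\<Pi> J\<in>F t. J)" "a = finsum Ore z (F t)"
      using a unfolding A_def by blast
    have yR: "y \<in> carrier Ore" using y ideal(1)[OF F(5)] by (auto simp: carrier_Ore)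
    have eq: "finsum Ore (z(X t := y)) (F t) = a"
      unfolding z(2) using F(4)[of t] y_carrier[OF z(1)] by (intro poly.M.finsum_cong') auto
    have "z(X t := y) \<in> (\<Pi> J\<in>F (Suc t). J)"
      using z(1) y F(3)[of t] by auto
    moreover have "finsum Ore (z(X t := y)) (F (Suc t)) = y \<oplus>\<^bsub>Ore\<^esub> a"
      unfolding F(3) eq[symmetric] using F(1,4)[of t] yR y_carrier[OF z(1)]
      by (subst poly.M.finsum_insert) auto
    moreover have "y \<oplus>\<^bsub>Ore\<^esub> a = a \<oplus>\<^bsub>Ore\<^esub> y"
      using yR a A_R[of t] by (intro poly.M.a_comm) (auto simp: carrier_Ore)
    ultimately show ?thesis
      by (intro exI[of _ "z(X t := y)"]) simp
  qed
  have "separated (A t) (A (Suc t))" for t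
  proof -
    note J = ideal[OF F(5)[of t]]
    define \<Phi> where "\<Phi> = {(a \<oplus>\<^bsub>Ore\<^esub> y, y) | a y. a \<in> A t \<and> y \<in> X t}"
    have "\<Phi> \<subseteq> A (Suc t) \<times> up R"
    proof
      fix p assume "p \<in> \<Phi>"
      then obtain a y where ay: "a \<in> A t" "y \<in> X t" "p = (a \<oplus>\<^bsub>Ore\<^esub> y, y)"
        unfolding \<Phi>_def by blast
      then obtain z where "z \<in> (\<Pi> J\<in>F (Suc t). J)" "finsum Ore z (F (Suc t)) = a \<oplus>\<^bsub>Ore\<^esub> y"
        using sum_insert by blast
      then have "a \<oplus>\<^bsub>Ore\<^esub> y \<in> A (Suc t)"
        unfolding A_def by (metis (mono_tags, lifting) mem_Collect_eq)
      then show "p \<in> A (Suc t) \<times> up R" using ay J(1) by auto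
    qed
    moreover have "\<forall>(f, g)\<in>\<Phi>. \<forall>(f', g')\<in>\<Phi>. (f \<oplus>\<^bsub>Ore\<^esub> f', g \<oplus>\<^bsub>Ore\<^esub> g') \<in> \<Phi>"
    proof clarify
      fix f g f' g' assume "(f, g) \<in> \<Phi>" "(f', g') \<in> \<Phi>"
      then obtain a a' where *: "a \<in> A t" "a' \<in> A t" "g \<in> X t" "g' \<in> X t"
        "f = a \<oplus>\<^bsub>Ore\<^esub> g" "f' = a' \<oplus>\<^bsub>Ore\<^esub> g'"
        unfolding \<Phi>_def by blast
      have "a \<in> carrier Ore" "a' \<in> carrier Ore" "g \<in> carrier Ore" "g' \<in> carrier Ore"
        using * A_R J(1) by (auto simp: carrier_Ore)
      then have "f \<oplus>\<^bsub>Ore\<^esub> f' = (a \<oplus>\<^bsub>Ore\<^esub> a') \<oplus>\<^bsub>Ore\<^esub> (g \<oplus>\<^bsub>Ore\<^esub> g')"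
        using * by (simp add: poly.M.add.m_ac)
      then show "(f \<oplus>\<^bsub>Ore\<^esub> f', g \<oplus>\<^bsub>Ore\<^esub> g') \<in> \<Phi>"
        unfolding \<Phi>_def using A_add[OF *(1,2)] J(3)[OF *(3,4)] by blast
    qed
    moreover have "\<forall>s\<in>up R. \<forall>(f, g)\<in>\<Phi>. (s \<otimes>\<^bsub>Ore\<^esub> f, s \<otimes>\<^bsub>Ore\<^esub> g) \<in> \<Phi>"
    proof clarify
      fix s f g assume s: "s \<in> up R" and "(f, g) \<in> \<Phi>"
      then obtain a where *: "a \<in> A t" "g \<in> X t" "f = a \<oplus>\<^bsub>Ore\<^esub> g"
        unfolding \<Phi>_def by blast
      then have "s \<otimes>\<^bsub>Ore\<^esub> f = s \<otimes>\<^bsub>Ore\<^esub> a \<oplus>\<^bsub>Ore\<^esub> s \<otimes>\<^bsub>Ore\<^esub> g"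
        using s A_R[of t] J(1) S.r_distr[of a g s] by (auto simp: carrier_Ore)
      then show "(s \<otimes>\<^bsub>Ore\<^esub> f, s \<otimes>\<^bsub>Ore\<^esub> g) \<in> \<Phi>"
        unfolding \<Phi>_def using A_mult[OF s *(1)] J(4)[OF s *(2)] by blast
    qed
    moreover have "\<forall>a\<in>A t. (a, \<zero>\<^bsub>Ore\<^esub>) \<in> \<Phi>"
    proof
      fix a assume a: "a \<in> A t"
      then have "a = a \<oplus>\<^bsub>Ore\<^esub> \<zero>\<^bsub>Ore\<^esub>" using A_R[of t] by (simp add: subset_iff carrier_Ore)
      then show "(a, \<zero>\<^bsub>Ore\<^esub>) \<in> \<Phi>"
        unfolding \<Phi>_def using a J(2) by blast
    qed
    moreover have "\<forall>g. (\<zero>\<^bsub>Ore\<^esub>, g) \<in> \<Phi> \<longrightarrow> g = \<zero>\<^bsub>Ore\<^esub>"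
    proof (intro allI impI)
      fix g assume "(\<zero>\<^bsub>Ore\<^esub>, g) \<in> \<Phi>"
      then obtain a where a: "a \<in> A t" "g \<in> X t" "a \<oplus>\<^bsub>Ore\<^esub> g = \<zero>\<^bsub>Ore\<^esub>"
        unfolding \<Phi>_def by auto
      then obtain z where z: "z \<in> (\<Pi> J\<in>F (Suc t). J)" "finsum Ore z (F (Suc t)) = \<zero>\<^bsub>Ore\<^esub>" "z (X t) = g"
        using sum_insert[OF a(1,2)] by auto
      then have "\<forall>J\<in>F (Suc t). z J = \<zero>\<^bsub>Ore\<^esub>"
        using dir F(1,2)[of "Suc t"] unfolding direct_left_ideals_def by blast
      then show "g = \<zero>\<^bsub>Ore\<^esub>"
        using z(3) F(3)[of t] by simp
    qed
    moreover have "\<exists>(f, g)\<in>\<Phi>. g \<noteq> \<zero>\<^bsub>Ore\<^esub>"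
    proof -
      obtain y where "y \<in> X t" "y \<noteq> \<zero>\<^bsub>Ore\<^esub>"
        using \<J>(2) F(5)[of t] J(2) by blast
      then show ?thesis
        using A_zero[of t] unfolding \<Phi>_def by blast
    qed
    ultimately show ?thesis
      unfolding separated_def using A_submod by blast
  qed
  then show False
    by (rule no_separated_sequence[OF ns fin inj])
qed

section \<open>Semiprimeness of the Ore extension\<close>

text \<open>If \<open>f S f = 0\<close>, then \<open>y \<sigma>\<^sup>n(y) = 0\<close> for all \<open>n \<ge> deg f\<close> and every left multiple \<open>y\<close> of
  the leading coefficient. When \<open>y\<^sup>2 \<noteq> 0\<close>, suitable multiples of the elements \<open>\<sigma>\<^sup>k\<^sup>q(y)\<close> with
  \<open>q = deg f + 1\<close> therefore generate an infinite direct sum of left ideals of \<open>R\<close>.\<close>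

lemma semiprime_Ore:
  assumes sp: "semiprime_ring R" and ns: left_nonsingular
    and fin: "finite_left_uniform_dim R" and inj: "inj_on \<sigma> (carrier R)"
  shows "semiprime_ring Ore"
proof (rule semiprime_ringI[OF ring_Ore], rule ccontr)
  interpret S: ring Ore by (rule ring_Ore)
  fix f assume f: "f \<in> carrier Ore" "\<forall>s\<in>carrier Ore. f \<otimes>\<^bsub>Ore\<^esub> s \<otimes>\<^bsub>Ore\<^esub> f = \<zero>\<^bsub>Ore\<^esub>" "f \<noteq> \<zero>\<^bsub>Ore\<^esub>"
  have fR: "f \<in> up R" using f(1) by (simp add: carrier_Ore)
  obtain d where d: "f d \<noteq> \<zero>" "\<forall>n>d. f n = \<zero>"
    using nonzero_degree[OF fR] f(3) by (auto simp: zero_Ore)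
  obtain r where r: "r \<in> carrier R" and sq: "(r \<otimes> f d) \<otimes> (r \<otimes> f d) \<noteq> \<zero>"
    using semiprime_multiple_square_nonzero[OF sp mem_upD[OF fR] d(1)] by blast
  define y where "y = r \<otimes> f d"
  have yR: "y \<in> carrier R" using r mem_upD[OF fR] by (simp add: y_def)
  define g where "g = scaled_pow r 0 \<otimes>\<^bsub>Ore\<^esub> f"
  have g_eq: "g = (\<lambda>n. r \<otimes> f n)" using r fR by (simp add: g_def scaled_pow_mult)
  have gR: "g \<in> up R" unfolding g_def using r fR by (intro mult_closed up_monom)
  have gd: "\<forall>n>d. g n = \<zero>" "g d = y" using d r by (simp_all add: g_eq y_def)
  \<comment> \<open>With \<open>g = r f\<close>, the product \<open>g x^j g\<close> is
    \<open>r\<close> times an element of \<open>f S f\<close>, hence zero. Its coefficient at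
    \<open>2 d + j\<close> is the product in question.\<close>
  have zero: "y \<otimes> (\<sigma> ^^ (d + j)) y = \<zero>" for j
  proof -
    have pR: "scaled_pow \<one> j \<in> carrier Ore" "scaled_pow r 0 \<in> carrier Ore"
      using r by (auto simp: carrier_Ore up_monom)
    have "(shift ^^ j) g = scaled_pow \<one> j \<otimes>\<^bsub>Ore\<^esub> (scaled_pow r 0 \<otimes>\<^bsub>Ore\<^esub> f)"
      using gR by (simp add: scaled_pow_mult(2) flip: g_def)
    then have "g \<otimes>\<^bsub>Ore\<^esub> (shift ^^ j) g
        = scaled_pow r 0 \<otimes>\<^bsub>Ore\<^esub> (f \<otimes>\<^bsub>Ore\<^esub> (scaled_pow \<one> j \<otimes>\<^bsub>Ore\<^esub> scaled_pow r 0) \<otimes>\<^bsub>Ore\<^esub> f)"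
      using f(1) pR by (simp add: g_def S.m_assoc)
    also have "\<dots> = \<zero>\<^bsub>Ore\<^esub>"
      using f(1,2) pR by simp
    finally have "(g \<otimes>\<^bsub>Ore\<^esub> (shift ^^ j) g) (d + (d + j)) = \<zero>"
      by (simp add: zero_Ore)
    moreover have "(g \<otimes>\<^bsub>Ore\<^esub> (shift ^^ j) g) (d + (d + j)) = y \<otimes> (\<sigma> ^^ d) ((\<sigma> ^^ j) y)"
      using mult_top_coeff[OF gR gd(1), of "(shift ^^ j) g" "d + j"] shift_pow_degree[OF gR gd(1), of j] gR
      by (simp add: gd(2))
    ultimately show ?thesis
      by (simp add: funpow_add)
  qed
  \<comment> \<open>For \<open>i < k\<close> the exponents differ by at least \<open>d + 1\<close>,
    so a power of \<open>\<sigma>\<close> applied to \<open>zero\<close> gives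
    \<open>a i \<otimes> a k = \<zero>\<close>.\<close>
  define a where "a k = (\<sigma> ^^ (k * Suc d)) y" for k
  have aR: "a k \<in> carrier R" for k using yR by (simp add: a_def)
  have a_zero: "a i \<otimes> a k = \<zero>" if "i < k" for i k
  proof -
    obtain l where l: "k = i + Suc l" using less_imp_Suc_add[OF \<open>i < k\<close>] by auto
    have "k * Suc d = i * Suc d + (d + (1 + l * Suc d))"
      by (simp add: l algebra_simps)
    then have "a k = (\<sigma> ^^ (i * Suc d)) ((\<sigma> ^^ (d + (1 + l * Suc d))) y)"
      unfolding a_def by (simp only: funpow_add comp_apply)
    then have "a i \<otimes> a k = (\<sigma> ^^ (i * Suc d)) (y \<otimes> (\<sigma> ^^ (d + (1 + l * Suc d))) y)"
      unfolding a_def[of i] using yR by (simp only: sigma_pow_mult sigma_pow_closed)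
    then show ?thesis by (simp only: zero sigma_pow_zero)
  qed
  \<comment> \<open>The square of \<open>a k\<close> is nonzero but may have a nonzero left
    annihilator. By nonsingularity that annihilator is not essential, and \<open>b\<close> generates
    a nonzero left ideal that avoids it.\<close>
  have "\<exists>b\<in>carrier R. b \<noteq> \<zero> \<and> (\<forall>c\<in>carrier R. (c \<otimes> b) \<otimes> (a k \<otimes> a k) = \<zero> \<longrightarrow> c \<otimes> b = \<zero>)" for k
  proof -
    have "a k \<otimes> a k = (\<sigma> ^^ (k * Suc d)) (y \<otimes> y)"
      unfolding a_def using yR by (simp add: sigma_pow_mult)
    then have "a k \<otimes> a k \<noteq> \<zero>"
      using sigma_pow_eq_zero[OF inj, of "y \<otimes> y"] yR sq by (auto simp: y_def)
    then have "\<not> left_essential {s \<in> carrier R. s \<otimes> (a k \<otimes> a k) = \<zero>}"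
      using ns aR[of k] unfolding left_nonsingular_def by blast
    then show ?thesis
      unfolding left_essential_def by auto
  qed
  then obtain b where b: "b k \<in> carrier R" "b k \<noteq> \<zero>"
    "\<And>c. \<lbrakk>c \<in> carrier R; (c \<otimes> b k) \<otimes> (a k \<otimes> a k) = \<zero>\<rbrakk> \<Longrightarrow> c \<otimes> b k = \<zero>" for k
    by metis
  show False
  \<comment> \<open>The left annihilator of \<open>a k\<close> contains every earlier
    \<open>b i \<otimes> a i\<close>, since \<open>a i \<otimes> a k = \<zero>\<close>. If it
    contains \<open>s \<otimes> (b k \<otimes> a k)\<close>, then \<open>s \<otimes> b k\<close>
    annihilates the square of \<open>a k\<close> and vanishes by the choice of
    \<open>b k\<close>.\<close>
  proof (rule no_independent_sequence[OF fin, of "\<lambda>k. b k \<otimes> a k" "\<lambda>k. {s \<in> carrier R. s \<otimes> a k = \<zero>}"])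
    fix k :: nat
    show "b k \<otimes> a k \<in> carrier R" using aR b(1) by simp
    show "b k \<otimes> a k \<noteq> \<zero>"
    proof
      assume "b k \<otimes> a k = \<zero>"
      then have "(\<one> \<otimes> b k) \<otimes> (a k \<otimes> a k) = \<zero>"
        using aR b(1) by (simp flip: m_assoc)
      then show False using b(3)[of \<one> k] b(1,2)[of k] by simp
    qed
    show "regular.submod {s \<in> carrier R. s \<otimes> a k = \<zero>}"
      using aR by (auto simp: regular.submod_def l_distr m_assoc)
    show "b i \<otimes> a i \<in> {s \<in> carrier R. s \<otimes> a k = \<zero>}" if "i < k" for i
      using aR b(1) a_zero[OF that] by (simp add: m_assoc)
    show "s \<otimes> (b k \<otimes> a k) = \<zero>"
      if s: "s \<in> carrier R" "s \<otimes> (b k \<otimes> a k) \<in> {s \<in> carrier R. s \<otimes> a k = \<zero>}" for s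
    proof -
      have "(s \<otimes> b k) \<otimes> (a k \<otimes> a k) = \<zero>"
        using s aR[of k] b(1)[of k] by (simp add: m_assoc)
      then have "s \<otimes> b k = \<zero>" using b(3) s(1) by blast
      then show ?thesis using s(1) aR[of k] b(1)[of k] by (simp flip: m_assoc)
    qed
  qed
qed

end

theorem theorem3p8:
  fixes R :: "('a, 'm) ring_scheme" and \<sigma> \<delta> :: "'a \<Rightarrow> 'a"
  assumes "ring R"
    and "semiprime_ring R" and "left_goldie_ring R"
    and "\<sigma> \<in> ring_hom R R" and "inj_on \<sigma> (carrier R)"
    and "skew_derivation R \<sigma> \<delta>"
  shows "semiprime_ring (ore_extension R \<sigma> \<delta>) \<and> left_goldie_ring (ore_extension R \<sigma> \<delta>)"
proof -
  interpret ring R by fact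
  interpret ore R \<sigma> \<delta>
    by unfold_locales fact+
  have fin: "finite_left_uniform_dim R" and acc: "acc_left_annihilators R"
    using \<open>left_goldie_ring R\<close> by (simp_all add: left_goldie_ring_def)
  note ns = semiprime_acc_left_nonsingular[OF \<open>semiprime_ring R\<close> acc]
  show ?thesis
    using semiprime_Ore[OF \<open>semiprime_ring R\<close> ns fin] finite_left_uniform_dim_Ore[OF ns fin]
      acc_left_annihilators_Ore[OF ns fin] ring_Ore \<open>inj_on \<sigma> (carrier R)\<close>
    by (simp add: left_goldie_ring_def)
qed

end
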